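(* Let $N_t$ be the self-exciting point process with rate function $\lambda$ and initial condition $\gamma\ge 0$, and assume that $\lambda$ is $\alpha$-Lipschitz for some $0<\alpha<1$. Let $Y_t=\frac{N_t}{t+1}$, and let $\bar Y_t$ be the deterministic solution of $$\frac{d\bar Y_t}{dt}=\frac{\lambda(\bar Y_t)-\bar Y_t}{t+1},\qquad \bar Y_0=Y_0 .$$ Then $Y_t$ converges, as $t\to\infty$, to the unique fixed point of $x=\lambda(x)$ in the $L^2(\mathbb{P})$ norm. Moreover, as $t\to\infty$, $$\mathbb{E}[(Y_t-\bar Y_t)^2]=\begin{cases}O\left(\frac1t\right) & \text{if } 0<\alpha<\frac12,\\ O\left(\frac{1}{t^{2(1-\alpha)}}\right) & \text{if } \frac12<\alpha<1,\\ O\left(\frac{\log t}{t}\right) & \text{if } \alpha=\frac12.\end{cases}$$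
   Context: Model: $\lambda:\mathbb{R}_{\ge 0}\to\mathbb{R}_{\ge 0}$ and $\gamma\ge 0$ are given; $N_t$ is a simple point process on $(0,\infty)$ with $N_0=0$ (empty past history) whose intensity at time $t$ with respect to its natural filtration is $\lambda_t=\lambda\left(\frac{N_{t-}+\gamma}{t+1}\right)$. Standing assumptions: $\lambda$ is increasing and continuously differentiable; the equation $x=\lambda(x)$ has finitely many solutions, and each solution $x^*$ satisfies either $\lambda'(x^* )<1$ or $\lambda'(x^* )>1$. *)

theory Defs
  imports "HOL-Probability.Probability"
begin

text \<open>
  A simple point process on $(0,\infty)$ is given by its random, locally finite set of points
  \<open>pts \<omega>\<close>; its counting process is \<open>counting pts t \<omega>\<close> (so it vanishes at time 0 and
  has unit jumps), and \<open>counting_left\<close> is the left limit of the latter.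
\<close>

definition counting :: "('a \<Rightarrow> real set) \<Rightarrow> real \<Rightarrow> 'a \<Rightarrow> nat" where
  "counting pts t \<omega> = card (pts \<omega> \<inter> {0<..t})"

definition counting_left :: "('a \<Rightarrow> real set) \<Rightarrow> real \<Rightarrow> 'a \<Rightarrow> nat" where
  "counting_left pts t \<omega> = card (pts \<omega> \<inter> {0<..<t})"

definition simple_point_process :: "'a measure \<Rightarrow> ('a \<Rightarrow> real set) \<Rightarrow> bool" where
  "simple_point_process M pts \<longleftrightarrow>
     (\<forall>\<omega>\<in>space M. pts \<omega> \<subseteq> {0<..} \<and> (\<forall>t. finite (pts \<omega> \<inter> {0<..t}))) \<and>
     (\<forall>t. counting pts t \<in> measurable M (count_space UNIV))"

definition natural_filtration :: "'a measure \<Rightarrow> ('a \<Rightarrow> real set) \<Rightarrow> real \<Rightarrow> 'a measure" where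
  "natural_filtration M pts t =
     sigma (space M) {counting pts s -` B \<inter> space M | s B. 0 \<le> s \<and> s \<le> t}"

text \<open>The predictable $\sigma$-algebra on $(0,\infty)\times\Omega$.\<close>

definition predictable_algebra :: "'a measure \<Rightarrow> ('a \<Rightarrow> real set) \<Rightarrow> (real \<times> 'a) measure" where
  "predictable_algebra M pts =
     sigma ({0<..} \<times> space M)
       {{s<..t} \<times> A | s t A. 0 \<le> s \<and> s \<le> t \<and> A \<in> sets (natural_filtration M pts s)}"

text \<open>
  \<open>L\<close> is an intensity of the point process with respect to its natural filtration: it is
  nonnegative, progressively measurable and locally integrable, and
  \[ \mathbb{E}\int_0^\infty C_s \, dN_s = \mathbb{E}\int_0^\infty C_s L_s \, ds \]
  for every nonnegative predictable process \<open>C\<close>. The integral against $dN$ is the sum over the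
  points. Testing only against $C = 1_{(a,b]\times A}$ with \<open>a\<close>, \<open>b\<close> deterministic would not be
  enough: that version can degenerate to $\infty = \infty$ for processes without first moment.
\<close>

definition has_intensity ::
    "'a measure \<Rightarrow> ('a \<Rightarrow> real set) \<Rightarrow> (real \<Rightarrow> 'a \<Rightarrow> real) \<Rightarrow> bool" where
  "has_intensity M pts L \<longleftrightarrow>
     (\<forall>t\<ge>0. \<forall>\<omega>\<in>space M. 0 \<le> L t \<omega>) \<and>
     (\<forall>t\<ge>0. (\<lambda>(s, \<omega>). L s \<omega>) \<in>
        borel_measurable (restrict_space borel {0..t} \<Otimes>\<^sub>M natural_filtration M pts t)) \<and>
     (\<forall>t\<ge>0. AE \<omega> in M. (\<integral>\<^sup>+s\<in>{0..t}. ennreal (L s \<omega>) \<partial>lborel) < \<infinity>) \<and>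
     (\<forall>C :: real \<times> 'a \<Rightarrow> ennreal. C \<in> borel_measurable (predictable_algebra M pts) \<longrightarrow>
        (\<integral>\<^sup>+\<omega>. (\<integral>\<^sup>+s. C (s, \<omega>) \<partial>count_space (pts \<omega>)) \<partial>M) =
        (\<integral>\<^sup>+\<omega>. (\<integral>\<^sup>+s\<in>{0<..}. C (s, \<omega>) * ennreal (L s \<omega>) \<partial>lborel) \<partial>M))"

definition self_exciting_process ::
    "'a measure \<Rightarrow> ('a \<Rightarrow> real set) \<Rightarrow> (real \<Rightarrow> real) \<Rightarrow> real \<Rightarrow> bool" where
  "self_exciting_process M pts lam \<gamma> \<longleftrightarrow>
     prob_space M \<and> simple_point_process M pts \<and>
     has_intensity M pts (\<lambda>t \<omega>. lam ((real (counting_left pts t \<omega>) + \<gamma>) / (t + 1)))"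

definition normalized_count :: "('a \<Rightarrow> real set) \<Rightarrow> real \<Rightarrow> 'a \<Rightarrow> real" where
  "normalized_count pts t \<omega> = real (counting pts t \<omega>) / (t + 1)"

text \<open>
  Rate functions map $[0,\infty)$ to $[0,\infty)$; values of \<open>lam\<close> at negative arguments are
  irrelevant, and \<open>lam'\<close> is the (at 0 one-sided) derivative.
\<close>

definition rate_function :: "(real \<Rightarrow> real) \<Rightarrow> (real \<Rightarrow> real) \<Rightarrow> bool" where
  "rate_function lam lam' \<longleftrightarrow>
     (\<forall>x\<ge>0. 0 \<le> lam x) \<and>
     mono_on {0..} lam \<and>
     (\<forall>x\<ge>0. (lam has_real_derivative lam' x) (at x within {0..})) \<and>
     continuous_on {0..} lam' \<and>
     finite {x. 0 \<le> x \<and> x = lam x} \<and>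
     (\<forall>x\<ge>0. x = lam x \<longrightarrow> lam' x < 1 \<or> lam' x > 1)"

text \<open>
  Solutions of the fluid equation stay in $[0,\infty)$, the domain of the rate function.
\<close>

definition fluid_solution :: "(real \<Rightarrow> real) \<Rightarrow> real \<Rightarrow> (real \<Rightarrow> real) \<Rightarrow> bool" where
  "fluid_solution lam y0 y \<longleftrightarrow>
     y 0 = y0 \<and>
     (\<forall>t\<ge>0. 0 \<le> y t \<and>
        (y has_real_derivative (lam (y t) - y t) / (t + 1)) (at t within {0..}))"

definition tendsto_L2 :: "'a measure \<Rightarrow> (real \<Rightarrow> 'a \<Rightarrow> real) \<Rightarrow> real \<Rightarrow> bool" where
  "tendsto_L2 M X c \<longleftrightarrow>
     (\<forall>t\<ge>0. X t \<in> borel_measurable M \<and> integrable M (\<lambda>\<omega>. (X t \<omega>)\<^sup>2)) \<and>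
     ((\<lambda>t. sqrt (\<integral>\<omega>. (X t \<omega> - c)\<^sup>2 \<partial>M)) \<longlongrightarrow> 0) at_top"

end

theory Submission
  imports Defs
begin

text \<open>
  Since \<open>n\<^sup>2 = (\<Sum>k<n. 2 k + 1)\<close>, the intensity formula expresses the first two moments of \<open>N\<^sub>t\<close> as time
  integrals of continuous functions, so they are continuously differentiable. Put
  \<open>u\<^sub>t = (t + 1) y\<^sub>t\<close> for a fluid solution \<open>y\<close>, so that \<open>u' = lam y\<close>. Then \<open>v = E (N - u)\<^sup>2\<close> satisfies
  \<open>v' = E (2 (N - u) (rate - lam y) + rate) \<le> 2 \<alpha> v / (t + 1) + C\<close>, and the three rates are those of the
  solutions of the corresponding linear equation, divided by \<open>(t + 1)\<^sup>2\<close>. The fixed point is itself a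
  constant fluid solution, so the convergence in mean square is a special case.
\<close>

text \<open>The test processes used in the intensity formula see the past only through the left
  count. The points up to \<open>t\<close>, in increasing order, have left counts 0, 1, ...,
  \<open>N t - 1\<close>, so integrating \<open>g\<close> of the left count against the process
  gives, path by path, the sum of \<open>g k\<close> over \<open>k < N t\<close>. Hence every
  function of the count that vanishes at 0 and has nonnegative increments \<open>g\<close> obeys an
  evolution equation, without any martingale argument. The obstacle is finiteness: the formula is an
  identity in [0, infinity], which can be neither differentiated nor expanded into moments while
  both sides may be infinite. The increments are therefore first set to 0 above a level. The
  threshold 1/2 comes from a competition in the inequality for \<open>v\<close>: the homogeneous
  equation lets \<open>v\<close> grow like (t+1) to the power 2\<alpha>, while the constant forcing
  contributes linear growth. The larger of the two wins, and at equality the resonance produces a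
  logarithm.\<close>

section \<open>Sums over ordered points and a differential comparison principle\<close>

text \<open>Building the set up in increasing order works because a new maximum has the whole old
  set below it and does not change the counts of the earlier elements.\<close>

lemma sum_card_below:
  fixes A :: "'b::linorder set"
  assumes "finite A"
  shows "(\<Sum>s\<in>A. g (card (A \<inter> {..<s}))) = (\<Sum>k<card A. g k)"
  using assms
proof (induction A rule: finite_linorder_max_induct)
  case empty
  then show ?case by simp
next
  case (insert b A)
  have b: "b \<notin> A" and eq: "insert b A \<inter> {..<b} = A"
    using insert.hyps by auto
  have "insert b A \<inter> {..<s} = A \<inter> {..<s}" if "s \<in> A" for s
    using insert.hyps that by force
  then have "(\<Sum>s\<in>A. g (card (insert b A \<inter> {..<s}))) = (\<Sum>k<card A. g k)"
    using insert.IH by simp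
  then show ?case
    using insert.hyps(1) b by (simp add: eq add.commute del: Int_insert_left)
qed

text \<open>\<open>exp (- p)\<close> with \<open>p' = k\<close> is the integrating factor: it makes
  the weighted difference of \<open>f\<close> and \<open>w\<close> nonincreasing. Comparing with a
  supersolution \<open>w\<close> instead of an integral formula lets each range of \<alpha> supply
  its own explicit \<open>w\<close>.\<close>

lemma gronwall_differential:
  fixes f :: "real \<Rightarrow> real"
  assumes f: "\<And>t. 0 \<le> t \<Longrightarrow> (f has_real_derivative f' t) (at t within {0..})"
    and w: "\<And>t. 0 \<le> t \<Longrightarrow> (w has_real_derivative w' t) (at t within {0..})"
    and p: "\<And>t. 0 \<le> t \<Longrightarrow> (p has_real_derivative k t) (at t within {0..})"
    and f': "\<And>t. 0 \<le> t \<Longrightarrow> f' t \<le> k t * f t + c t"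
    and w': "\<And>t. 0 \<le> t \<Longrightarrow> k t * w t + c t \<le> w' t"
    and init: "f 0 \<le> w 0"
    and t: "0 \<le> t"
  shows "f t \<le> w t"
proof -
  define G where "G t = (f t - w t) * exp (- p t)" for t
  have G: "(G has_real_derivative (f' s - w' s - k s * (f s - w s)) * exp (- p s)) (at s within {0..t})"
    if "0 \<le> s" for s
  proof -
    have "(G has_real_derivative (f' s - w' s - k s * (f s - w s)) * exp (- p s)) (at s within {0..})"
      unfolding G_def
      by (rule derivative_eq_intros f[OF that] w[OF that] p[OF that] refl)+ (simp add: algebra_simps)
    then show ?thesis
      by (rule DERIV_subset) auto
  qed
  have neg: "(f' s - w' s - k s * (f s - w s)) * exp (- p s) \<le> 0" if "0 \<le> s" for s
    using f'[OF that] w'[OF that]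
    by (intro mult_nonpos_nonneg) (auto simp: algebra_simps)
  have "G t \<le> G 0"
  proof (rule DERIV_nonpos_imp_decreasing_open[OF t])
    show "\<exists>y. (G has_real_derivative y) (at s) \<and> y \<le> 0" if "0 < s" "s < t" for s
      using G[of s] neg[of s] that at_within_Icc_at[of 0 s t] by auto
    show "continuous_on {0..t} G"
      using G by (intro DERIV_continuous_on) auto
  qed
  then have "(f t - w t) * exp (- p t) \<le> (f 0 - w 0) * exp (- p 0)"
    by (simp add: G_def)
  also have "\<dots> \<le> 0"
    using init by (intro mult_nonpos_nonneg) auto
  finally show ?thesis
    by (simp add: mult_le_0_iff)
qed

section \<open>Left limits and predictability of the counting process\<close>

lemma counting_0 [simp]: "counting pts 0 \<omega> = 0"
  by (simp add: counting_def)

context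
  fixes M :: "'a measure" and pts :: "'a \<Rightarrow> real set"
  assumes pp: "simple_point_process M pts"
begin

lemma finite_pts: "\<omega> \<in> space M \<Longrightarrow> finite (pts \<omega> \<inter> {0<..t})"
  using pp by (auto simp: simple_point_process_def)

lemma pts_pos: "\<omega> \<in> space M \<Longrightarrow> s \<in> pts \<omega> \<Longrightarrow> 0 < s"
  using pp by (auto simp: simple_point_process_def)

lemma measurable_counting [measurable]: "counting pts t \<in> M \<rightarrow>\<^sub>M count_space UNIV"
  using pp by (auto simp: simple_point_process_def)

lemma counting_mono: "\<omega> \<in> space M \<Longrightarrow> s \<le> t \<Longrightarrow> counting pts s \<omega> \<le> counting pts t \<omega>"
  unfolding counting_def by (intro card_mono finite_pts) auto

lemma counting_left_eq:
  assumes "\<omega> \<in> space M" "t \<notin> pts \<omega>"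
  shows "counting_left pts t \<omega> = counting pts t \<omega>"
proof -
  have "pts \<omega> \<inter> {0<..<t} = pts \<omega> \<inter> {0<..t}"
  proof (intro set_eqI)
    fix x
    show "x \<in> pts \<omega> \<inter> {0<..<t} \<longleftrightarrow> x \<in> pts \<omega> \<inter> {0<..t}"
      using assms(2) by (cases "x = t") auto
  qed
  then show ?thesis
    by (simp add: counting_left_def counting_def)
qed

lemma counting_eventually_const:
  assumes \<omega>: "\<omega> \<in> space M" and t: "t \<notin> pts \<omega>"
  shows "\<forall>\<^sub>F s in nhds t. counting pts s \<omega> = counting pts t \<omega>"
proof -
  \<comment> \<open>Only the finitely many points up to \<open>t + 1\<close> matter near
    \<open>t\<close>; removing this finite, hence closed, set from a half-line leaves an open
    set.\<close>
  define A where "A = {..<t+1} - pts \<omega> \<inter> {0<..t+1}"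
  have "open A"
    unfolding A_def by (intro open_Diff finite_imp_closed finite_pts \<omega>) auto
  moreover have "t \<in> A"
    using t by (auto simp: A_def)
  ultimately obtain e where e: "e > 0" "ball t e \<subseteq> A"
    by (meson open_contains_ball)
  have gap: "x \<notin> pts \<omega>" if "dist t x < e" for x
  proof
    assume x: "x \<in> pts \<omega>"
    then have "0 < x"
      using pts_pos[OF \<omega>] by blast
    moreover have "x \<in> A"
      using e(2) that by auto
    ultimately show False
      using x by (auto simp: A_def)
  qed
  have "counting pts s \<omega> = counting pts t \<omega>" if s: "dist s t < e" for s
  proof -
    have "x \<le> s \<longleftrightarrow> x \<le> t" if "x \<in> pts \<omega>" for x
      using gap[of x] that s unfolding dist_real_def by linarith
    then have "pts \<omega> \<inter> {0<..s} = pts \<omega> \<inter> {0<..t}"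
      by auto
    then show ?thesis by (simp add: counting_def)
  qed
  then show ?thesis
    unfolding eventually_nhds_metric using e(1) by blast
qed

text \<open>A positive left count is already reached at a rational time between the last point
  before \<open>s\<close> and \<open>s\<close>. This reduces the left limit to countably many counts
  at fixed earlier times, which is what measurability jointly in time and outcome needs.\<close>

lemma le_counting_left_iff:
  assumes \<omega>: "\<omega> \<in> space M"
  shows "k \<le> counting_left pts s \<omega> \<longleftrightarrow> k = 0 \<or> (\<exists>r\<in>\<rat>. 0 \<le> r \<and> r < s \<and> k \<le> counting pts r \<omega>)"
proof
  assume k: "k \<le> counting_left pts s \<omega>"
  let ?A = "pts \<omega> \<inter> {0<..<s}"
  have fin: "finite ?A"
    by (rule finite_subset[OF _ finite_pts[OF \<omega>, of s]]) auto
  show "k = 0 \<or> (\<exists>r\<in>\<rat>. 0 \<le> r \<and> r < s \<and> k \<le> counting pts r \<omega>)"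
  proof (cases "k = 0")
    case False
    then have "?A \<noteq> {}"
      using k by (auto simp: counting_left_def)
    then have "Max ?A \<in> ?A"
      using fin by (rule Max_in[rotated])
    then obtain r where r: "r \<in> \<rat>" "Max ?A < r" "r < s"
      using Rats_dense_in_real[of "Max ?A" s] by auto
    have "?A \<subseteq> pts \<omega> \<inter> {0<..r}"
    proof
      fix x assume "x \<in> ?A"
      with Max_ge[OF fin this] r(2) show "x \<in> pts \<omega> \<inter> {0<..r}"
        by simp
    qed
    then have "counting_left pts s \<omega> \<le> counting pts r \<omega>"
      unfolding counting_left_def counting_def by (intro card_mono finite_pts \<omega>)
    then show ?thesis
      using r k \<open>Max ?A \<in> ?A\<close> by (intro disjI2 bexI[of _ r]) auto
  qed simp
next
  assume "k = 0 \<or> (\<exists>r\<in>\<rat>. 0 \<le> r \<and> r < s \<and> k \<le> counting pts r \<omega>)"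
  moreover have "counting pts r \<omega> \<le> counting_left pts s \<omega>" if "r < s" for r
    unfolding counting_left_def counting_def
    using that by (intro card_mono finite_subset[OF _ finite_pts[OF \<omega>, of s]]) auto
  ultimately show "k \<le> counting_left pts s \<omega>"
    by (auto intro: order.trans)
qed

text \<open>The \<sigma>-algebra \<open>P\<close> is left open because two instances are needed: the
  product \<sigma>-algebra for Fubini, and the predictable one for admissible test
  processes.\<close>

lemma measurable_counting_left_pair:
  assumes sp: "space P \<subseteq> UNIV \<times> space M"
    and P: "\<And>r k. 0 \<le> r \<Longrightarrow> {p \<in> space P. r < fst p \<and> k \<le> counting pts r (snd p)} \<in> sets P"
  shows "(\<lambda>p. counting_left pts (fst p) (snd p)) \<in> P \<rightarrow>\<^sub>M count_space UNIV"
proof -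
  let ?f = "\<lambda>p. counting_left pts (fst p) (snd p)"
  have ge: "{p \<in> space P. k \<le> ?f p} \<in> sets P" for k
  proof (cases "k = 0")
    case False
    have "{p \<in> space P. k \<le> ?f p} =
        (\<Union>r\<in>\<rat> \<inter> {0..}. {p \<in> space P. r < fst p \<and> k \<le> counting pts r (snd p)})"
    proof (intro set_eqI)
      fix p
      show "p \<in> {p \<in> space P. k \<le> ?f p} \<longleftrightarrow>
          p \<in> (\<Union>r\<in>\<rat> \<inter> {0..}. {p \<in> space P. r < fst p \<and> k \<le> counting pts r (snd p)})"
      proof (cases "p \<in> space P")
        case True
        then have "snd p \<in> space M"
          using sp by auto
        from le_counting_left_iff[OF this, of k "fst p"] show ?thesis
          using True False by auto
      qed auto
    qed
    also have "\<dots> \<in> sets P"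
      by (intro sets.countable_UN' countable_Int1 countable_rat) (auto intro!: P)
    finally show ?thesis .
  qed simp
  have "?f -` {k} \<inter> space P = {p \<in> space P. k \<le> ?f p} - {p \<in> space P. Suc k \<le> ?f p}" for k
    by auto
  then show ?thesis
    using ge by (auto simp: measurable_count_space_eq2_countable intro!: sets.Diff)
qed

lemma measurable_counting_left [measurable]:
  "(\<lambda>p. counting_left pts (fst p) (snd p)) \<in> borel \<Otimes>\<^sub>M M \<rightarrow>\<^sub>M count_space UNIV"
  by (rule measurable_counting_left_pair) (auto simp: space_pair_measure)

lemma natural_filtration_subset_Pow:
  "{counting pts s -` B \<inter> space M | s B. 0 \<le> s \<and> s \<le> t} \<subseteq> Pow (space M)"
  by auto

lemma space_natural_filtration [simp]: "space (natural_filtration M pts t) = space M"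
  unfolding natural_filtration_def by (rule space_measure_of) auto

lemma predictable_rectangles_subset_Pow:
  "{{s<..t} \<times> A | s t A. 0 \<le> s \<and> s \<le> t \<and> A \<in> sets (natural_filtration M pts s)}
    \<subseteq> Pow ({0<..} \<times> space M)"
proof -
  have "A \<subseteq> space M" if "A \<in> sets (natural_filtration M pts s)" for A s
    using sets.sets_into_space[OF that] by simp
  then have "{s<..t} \<times> A \<subseteq> {0<..} \<times> space M"
    if "0 \<le> s" "A \<in> sets (natural_filtration M pts s)" for s t A
    using that by (intro Sigma_mono) auto
  then show ?thesis by blast
qed

lemma space_predictable [simp]: "space (predictable_algebra M pts) = {0<..} \<times> space M"
  unfolding predictable_algebra_def by (rule space_measure_of[OF predictable_rectangles_subset_Pow])

lemma predictable_rectangle: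
  assumes "0 \<le> s" "s \<le> t" "A \<in> sets (natural_filtration M pts s)"
  shows "{s<..t} \<times> A \<in> sets (predictable_algebra M pts)"
  unfolding predictable_algebra_def
  using assms by (subst sets_measure_of[OF predictable_rectangles_subset_Pow]) (auto intro!: sigma_sets.Basic)

lemma measurable_fst_predictable [measurable]: "fst \<in> borel_measurable (predictable_algebra M pts)"
proof (rule borel_measurableI_le)
  fix a :: real
  have "{0<..a} \<times> space M \<in> sets (predictable_algebra M pts)" if "0 \<le> a"
    using that sets.top[of "natural_filtration M pts 0"] by (intro predictable_rectangle) auto
  moreover have "{p \<in> space (predictable_algebra M pts). fst p \<le> a} =
      (if 0 \<le> a then {0<..a} \<times> space M else {})"
    by auto
  ultimately show "{p \<in> space (predictable_algebra M pts). fst p \<le> a} \<in> sets (predictable_algebra M pts)"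
    by simp
qed

lemma measurable_counting_left_predictable [measurable]:
  "(\<lambda>p. counting_left pts (fst p) (snd p)) \<in> predictable_algebra M pts \<rightarrow>\<^sub>M count_space UNIV"
proof (rule measurable_counting_left_pair)
  fix r :: real and k :: nat
  assume r: "0 \<le> r"
  define A where "A = counting pts r -` {k..} \<inter> space M"
  have A: "A \<in> sets (natural_filtration M pts r)"
    unfolding natural_filtration_def A_def
    using r by (subst sets_measure_of[OF natural_filtration_subset_Pow]) (auto intro!: sigma_sets.Basic)
  \<comment> \<open>The generating rectangles are bounded in time, so the half-line after
    \<open>r\<close> is exhausted by the intervals from \<open>r\<close> to
    \<open>r + n\<close>.\<close>
  have "{p \<in> space (predictable_algebra M pts). r < fst p \<and> k \<le> counting pts r (snd p)}
      = (\<Union>n::nat. {r<..r + real n} \<times> A)"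
  proof -
    have "\<exists>n. x \<le> r + real n" for x
      using real_arch_simple[of "x - r"] by (auto simp: algebra_simps)
    then show ?thesis
      using r by (auto simp: A_def)
  qed
  also have "\<dots> \<in> sets (predictable_algebra M pts)"
    using r A by (auto intro!: predictable_rectangle)
  finally show "{p \<in> space (predictable_algebra M pts). r < fst p \<and> k \<le> counting pts r (snd p)}
      \<in> sets (predictable_algebra M pts)" .
qed (simp add: Sigma_mono)

end

section \<open>Campbell and Dynkin formulas\<close>

text \<open>\<alpha> is any Lipschitz constant below 1, not the least one, so the locale can be
  entered again with a larger constant for the same process.\<close>

locale lipschitz_self_exciting =
  fixes M :: "'a measure" and pts :: "'a \<Rightarrow> real set" and lam :: "real \<Rightarrow> real" and \<gamma> \<alpha> :: real
  assumes gamma: "0 \<le> \<gamma>"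
    and lam_nonneg: "\<And>x. 0 \<le> x \<Longrightarrow> 0 \<le> lam x"
    and process: "self_exciting_process M pts lam \<gamma>"
    and lipschitz: "\<alpha>-lipschitz_on {0..} lam"
    and alpha_less_1: "\<alpha> < 1"
begin

sublocale prob_space M
  using process by (simp add: self_exciting_process_def)

lemma pp: "simple_point_process M pts"
  using process by (simp add: self_exciting_process_def)

lemmas counting_measurable [measurable] = measurable_counting[OF pp]
lemmas counting_left_measurable [measurable] = measurable_counting_left[OF pp]

abbreviation N where "N \<equiv> counting pts"

definition rate where "rate t k = lam ((real k + \<gamma>) / (t + 1))"

lemma alpha_nonneg: "0 \<le> \<alpha>"
  using lipschitz by (rule lipschitz_on_nonneg)

lemma lam_lipschitz: "0 \<le> x \<Longrightarrow> 0 \<le> y \<Longrightarrow> \<bar>lam x - lam y\<bar> \<le> \<alpha> * \<bar>x - y\<bar>"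
  using lipschitz_onD[OF lipschitz, of x y] by (simp add: dist_real_def)

lemma continuous_lam: "continuous_on {0..} lam"
  using lipschitz by (rule lipschitz_on_continuous_on)

lemma rate_nonneg: "0 \<le> t \<Longrightarrow> 0 \<le> rate t k"
  unfolding rate_def using gamma by (intro lam_nonneg) auto

lemma continuous_rate: "continuous_on {0..} (\<lambda>t. rate t k)"
  unfolding rate_def using gamma
  by (intro continuous_on_compose2[OF continuous_lam] continuous_intros) auto

text \<open>Lipschitz continuity at 0 gives the affine bound. The shift \<gamma> is absorbed into
  the constant term, while the decaying slope is kept: it is what limits the mean to linear
  growth.\<close>

lemma rate_le:
  assumes "0 \<le> t"
  shows "rate t k \<le> lam 0 + \<alpha> * \<gamma> + \<alpha> / (t + 1) * real k"
proof -
  have "rate t k \<le> lam 0 + \<alpha> * ((real k + \<gamma>) / (t + 1))"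
    using lam_lipschitz[of "(real k + \<gamma>) / (t + 1)" 0] gamma assms by (simp add: rate_def)
  moreover have "\<alpha> * \<gamma> / (t + 1) \<le> \<alpha> * \<gamma> / 1"
    using assms gamma alpha_nonneg by (intro divide_left_mono) auto
  ultimately show ?thesis
    by (simp add: add_divide_distrib algebra_simps)
qed

text \<open>The test process is predictable because it looks at the path only through the left
  count. With \<open>g\<close> valued in \<open>ennreal\<close>, both sides may be infinite.\<close>

lemma campbell:
  fixes g :: "nat \<Rightarrow> ennreal"
  assumes [measurable]: "I \<in> sets borel" and I: "I \<subseteq> {0<..}"
  shows "(\<integral>\<^sup>+\<omega>. (\<integral>\<^sup>+s. indicator I s * g (counting_left pts s \<omega>) \<partial>count_space (pts \<omega>)) \<partial>M) =
    (\<integral>\<^sup>+\<omega>. (\<integral>\<^sup>+s. indicator I s * (g (counting_left pts s \<omega>) * ennreal (rate s (counting_left pts s \<omega>))) \<partial>lborel) \<partial>M)"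
proof -
  define C where "C p = indicator I (fst p) * g (counting_left pts (fst p) (snd p))" for p :: "real \<times> 'a"
  note [measurable] = measurable_counting_left_predictable[OF pp] measurable_fst_predictable[OF pp]
  have "C \<in> borel_measurable (predictable_algebra M pts)"
    unfolding C_def by measurable
  then have "(\<integral>\<^sup>+\<omega>. (\<integral>\<^sup>+s. C (s, \<omega>) \<partial>count_space (pts \<omega>)) \<partial>M) =
      (\<integral>\<^sup>+\<omega>. (\<integral>\<^sup>+s\<in>{0<..}. C (s, \<omega>) * ennreal (rate s (counting_left pts s \<omega>)) \<partial>lborel) \<partial>M)"
    using process unfolding self_exciting_process_def has_intensity_def rate_def by blast
  also have "\<dots> = (\<integral>\<^sup>+\<omega>. (\<integral>\<^sup>+s. indicator I s *
      (g (counting_left pts s \<omega>) * ennreal (rate s (counting_left pts s \<omega>))) \<partial>lborel) \<partial>M)"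
    using I by (intro nn_integral_cong) (auto simp: C_def indicator_def)
  finally show ?thesis
    by (simp add: C_def)
qed

lemma measurable_counting_left_at [measurable]: "counting_left pts t \<in> M \<rightarrow>\<^sub>M count_space UNIV"
  using measurable_compose[OF _ counting_left_measurable, of "\<lambda>\<omega>. (t, \<omega>)" M] by simp

text \<open>Measurability is assumed for the counts, not for the random set \<open>pts\<close>; this
  expresses the event that \<open>t\<close> is a point through two measurable counts.\<close>

lemma mem_pts_iff:
  assumes "\<omega> \<in> space M" "0 < t"
  shows "t \<in> pts \<omega> \<longleftrightarrow> counting_left pts t \<omega> \<noteq> N t \<omega>"
proof
  assume t: "t \<in> pts \<omega>"
  have "pts \<omega> \<inter> {0<..<t} \<subset> pts \<omega> \<inter> {0<..t}"
    using t assms by (intro psubsetI) auto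
  then show "counting_left pts t \<omega> \<noteq> N t \<omega>"
    unfolding counting_def counting_left_def
    using psubset_card_mono[OF finite_pts[OF pp assms(1)]] by (metis less_irrefl)
qed (use counting_left_eq[OF pp assms(1)] in auto)

text \<open>By \<open>campbell\<close> for \<open>I = {t}\<close>, the expected number of points at
  \<open>t\<close> is a Lebesgue integral over a singleton, hence 0.\<close>

lemma AE_not_mem_pts: "AE \<omega> in M. t \<notin> pts \<omega>"
proof (cases "0 < t")
  case True
  have [measurable]: "Measurable.pred M (\<lambda>\<omega>. counting_left pts t \<omega> \<noteq> N t \<omega>)"
    by (rule measurable_compose_countable[where f = "\<lambda>n \<omega>. counting_left pts t \<omega> \<noteq> n",
        OF _ counting_measurable]) measurable
  have "(\<integral>\<^sup>+\<omega>. (if counting_left pts t \<omega> \<noteq> N t \<omega> then 1 else 0) \<partial>M) =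
      (\<integral>\<^sup>+\<omega>. (\<integral>\<^sup>+s. indicator {t} s * 1 \<partial>count_space (pts \<omega>)) \<partial>M)"
  proof (intro nn_integral_cong)
    fix \<omega> assume \<omega>: "\<omega> \<in> space M"
    have "(\<integral>\<^sup>+s. indicator {t} s * 1 \<partial>count_space (pts \<omega>)) =
        (\<Sum>s\<in>pts \<omega> \<inter> {t}. indicator {t} s * (1::ennreal))"
      by (intro nn_integral_count_space') auto
    also have "\<dots> = (if t \<in> pts \<omega> then 1 else 0)"
      by auto
    finally show "(if counting_left pts t \<omega> \<noteq> N t \<omega> then 1 else 0) =
        (\<integral>\<^sup>+s. indicator {t} s * 1 \<partial>count_space (pts \<omega>))"
      using mem_pts_iff[OF \<omega> True] by simp
  qed
  also have "\<dots> = (\<integral>\<^sup>+\<omega>. (\<integral>\<^sup>+s. indicator {t} s *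
      (1 * ennreal (rate s (counting_left pts s \<omega>))) \<partial>lborel) \<partial>M)"
    using True campbell[of "{t}" "\<lambda>_. 1"] by simp
  also have "\<dots> = (\<integral>\<^sup>+\<omega>. 0 \<partial>M)"
  proof (intro nn_integral_cong)
    fix \<omega>
    have "(\<integral>\<^sup>+s. indicator {t} s * (1 * ennreal (rate s (counting_left pts s \<omega>))) \<partial>lborel) =
        (\<integral>\<^sup>+(s::real). 0 \<partial>lborel)"
    proof (rule nn_integral_cong_AE)
      show "AE s in lborel. indicator {t} s * (1 * ennreal (rate s (counting_left pts s \<omega>))) = 0"
        using AE_lborel_singleton[of t] by eventually_elim simp
    qed
    then show "(\<integral>\<^sup>+s. indicator {t} s * (1 * ennreal (rate s (counting_left pts s \<omega>))) \<partial>lborel) = 0"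
      by simp
  qed
  finally have "(\<integral>\<^sup>+\<omega>. (if counting_left pts t \<omega> \<noteq> N t \<omega> then 1 else 0) \<partial>M) = 0"
    by simp
  then have "AE \<omega> in M. (if counting_left pts t \<omega> \<noteq> N t \<omega> then 1 else (0::ennreal)) = 0"
    by (subst (asm) nn_integral_0_iff_AE) measurable
  then show ?thesis
    using AE_space
  proof eventually_elim
    case (elim \<omega>)
    then show ?case
      using mem_pts_iff[OF elim(2) True] by (auto split: if_splits)
  qed
next
  case False
  then show ?thesis
    using pts_pos[OF pp] by (intro AE_I2) auto
qed

text \<open>Deterministic times carry no point almost surely, so the left limits in the intensity disappear.\<close>

lemma nn_expectation_sum_counting:
  fixes g :: "nat \<Rightarrow> ennreal"
  shows "(\<integral>\<^sup>+\<omega>. (\<Sum>k<N t \<omega>. g k) \<partial>M) =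
    (\<integral>\<^sup>+s. indicator {0..t} s * (\<integral>\<^sup>+\<omega>. g (N s \<omega>) * ennreal (rate s (N s \<omega>)) \<partial>M) \<partial>lborel)"
proof -
  interpret P: pair_sigma_finite lborel M
    by unfold_locales
  let ?L = "\<lambda>s \<omega>. counting_left pts s \<omega>"
  define H where "H s \<omega> = indicator {0<..t} s * (g (?L s \<omega>) * ennreal (rate s (?L s \<omega>)))" for s \<omega>
  \<comment> \<open>\<open>lam\<close> is controlled only on the nonnegative half-line. Freezing
    negative arguments at 0 yields a Borel function on the whole line that agrees with
    \<open>lam\<close> at every argument occurring in \<open>H\<close>.\<close>
  have "continuous_on UNIV (\<lambda>x. lam (max 0 x))"
    by (intro continuous_on_compose2[OF continuous_lam] continuous_intros) auto
  then have [measurable]: "(\<lambda>x. lam (max 0 x)) \<in> borel_measurable borel"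
    by (rule borel_measurable_continuous_onI)
  define h where "h k p = indicator {0<..t} (fst p) *
      (g k * ennreal (lam (max 0 ((real k + \<gamma>) / (fst p + 1)))))" for k :: nat and p :: "real \<times> 'a"
  have "(\<lambda>p. h (?L (fst p) (snd p)) p) \<in> borel_measurable (borel \<Otimes>\<^sub>M M)"
    unfolding h_def
    by (rule measurable_compose_countable[OF _ counting_left_measurable]) measurable
  also have "(\<lambda>p. h (?L (fst p) (snd p)) p) = case_prod H"
    using gamma by (auto simp: H_def h_def rate_def indicator_def fun_eq_iff)
  finally have H: "case_prod H \<in> borel_measurable (lborel \<Otimes>\<^sub>M M)"
    by simp
  have "(\<integral>\<^sup>+\<omega>. (\<Sum>k<N t \<omega>. g k) \<partial>M) =
      (\<integral>\<^sup>+\<omega>. (\<integral>\<^sup>+s. indicator {0<..t} s * g (?L s \<omega>) \<partial>count_space (pts \<omega>)) \<partial>M)"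
  proof (intro nn_integral_cong)
    fix \<omega> assume \<omega>: "\<omega> \<in> space M"
    let ?A = "pts \<omega> \<inter> {0<..t}"
    have "(\<integral>\<^sup>+s. indicator {0<..t} s * g (?L s \<omega>) \<partial>count_space (pts \<omega>)) =
        (\<Sum>s\<in>?A. indicator {0<..t} s * g (?L s \<omega>))"
      by (intro nn_integral_count_space' finite_pts[OF pp \<omega>]) (auto simp: indicator_def)
    also have "\<dots> = (\<Sum>s\<in>?A. g (card (?A \<inter> {..<s})))"
    proof (intro sum.cong refl)
      fix s assume s: "s \<in> ?A"
      then have "pts \<omega> \<inter> {0<..<s} = ?A \<inter> {..<s}"
        by auto
      then show "indicator {0<..t} s * g (?L s \<omega>) = g (card (?A \<inter> {..<s}))"
        using s by (simp add: counting_left_def)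
    qed
    also have "\<dots> = (\<Sum>k<N t \<omega>. g k)"
      unfolding counting_def by (rule sum_card_below[OF finite_pts[OF pp \<omega>]])
    finally show "(\<Sum>k<N t \<omega>. g k) =
        (\<integral>\<^sup>+s. indicator {0<..t} s * g (?L s \<omega>) \<partial>count_space (pts \<omega>))" ..
  qed
  also have "\<dots> = (\<integral>\<^sup>+\<omega>. (\<integral>\<^sup>+s. H s \<omega> \<partial>lborel) \<partial>M)"
    unfolding H_def by (rule campbell) auto
  also have "\<dots> = (\<integral>\<^sup>+s. (\<integral>\<^sup>+\<omega>. H s \<omega> \<partial>M) \<partial>lborel)"
    by (rule P.Fubini'[OF H])
  also have "\<dots> = (\<integral>\<^sup>+s. indicator {0..t} s *
      (\<integral>\<^sup>+\<omega>. g (N s \<omega>) * ennreal (rate s (N s \<omega>)) \<partial>M) \<partial>lborel)"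
  proof (rule nn_integral_cong_AE)
    \<comment> \<open>The half-open and the closed interval differ only at time 0, a Lebesgue null
      set.\<close>
    show "AE s in lborel. (\<integral>\<^sup>+\<omega>. H s \<omega> \<partial>M) = indicator {0..t} s *
        (\<integral>\<^sup>+\<omega>. g (N s \<omega>) * ennreal (rate s (N s \<omega>)) \<partial>M)"
      using AE_lborel_singleton[of 0]
    proof eventually_elim
      case (elim s)
      have "(\<integral>\<^sup>+\<omega>. H s \<omega> \<partial>M) = (\<integral>\<^sup>+\<omega>. indicator {0..t} s *
          (g (N s \<omega>) * ennreal (rate s (N s \<omega>))) \<partial>M)"
      proof (rule nn_integral_cong_AE)
        show "AE \<omega> in M. H s \<omega> = indicator {0..t} s * (g (N s \<omega>) * ennreal (rate s (N s \<omega>)))"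
          using AE_not_mem_pts[of s] AE_space
        proof eventually_elim
          case (elim \<omega>)
          then show ?case
            using counting_left_eq[OF pp elim(2) elim(1)] \<open>s \<noteq> 0\<close>
            by (auto simp: H_def indicator_def)
        qed
      qed
      also have "\<dots> = indicator {0..t} s * (\<integral>\<^sup>+\<omega>. g (N s \<omega>) * ennreal (rate s (N s \<omega>)) \<partial>M)"
        by (rule nn_integral_cmult) measurable
      finally show ?case .
    qed
  qed
  finally show ?thesis .
qed

text \<open>Paths jump, but almost none jumps at the given time \<open>a\<close>. Along a sequence
  tending to \<open>a\<close> the count is then eventually constant, only the explicit time
  dependence of \<open>F\<close> remains, and dominated convergence applies.\<close>

lemma continuous_expectation_counting:
  fixes F :: "real \<Rightarrow> nat \<Rightarrow> real"
  assumes F: "\<And>k. continuous_on {0..} (\<lambda>s. F s k)"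
    and dom: "\<And>T. \<exists>W. integrable M W \<and> (\<forall>s\<in>{0..T}. \<forall>\<omega>\<in>space M. \<bar>F s (N s \<omega>)\<bar> \<le> W \<omega>)"
  shows "continuous_on {0..} (\<lambda>s. expectation (\<lambda>\<omega>. F s (N s \<omega>)))"
  unfolding continuous_on_sequentially
proof (intro allI ballI impI)
  fix x :: "nat \<Rightarrow> real" and a :: real
  assume a: "a \<in> {0..}" and x: "(\<forall>n. x n \<in> {0..}) \<and> x \<longlonglongrightarrow> a"
  then have "Bseq x"
    by (blast intro: convergent_imp_Bseq convergentI)
  \<comment> \<open>A convergent sequence stays in one bounded interval, on which a single
    dominating function is available.\<close>
  then obtain T where T: "\<And>n. \<bar>x n\<bar> \<le> T"
    by (auto simp: Bseq_def)
  obtain W where W: "integrable M W" "\<And>s \<omega>. s \<in> {0..T} \<Longrightarrow> \<omega> \<in> space M \<Longrightarrow> \<bar>F s (N s \<omega>)\<bar> \<le> W \<omega>"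
    using dom[of T] by blast
  have "(\<lambda>n. expectation (\<lambda>\<omega>. F (x n) (N (x n) \<omega>))) \<longlonglongrightarrow> expectation (\<lambda>\<omega>. F a (N a \<omega>))"
  proof (rule integral_dominated_convergence[OF _ _ W(1)])
    show "AE \<omega> in M. (\<lambda>n. F (x n) (N (x n) \<omega>)) \<longlonglongrightarrow> F a (N a \<omega>)"
      using AE_not_mem_pts[of a] AE_space
    proof eventually_elim
      case (elim \<omega>)
      have "\<forall>\<^sub>F n in sequentially. N (x n) \<omega> = N a \<omega>"
        using counting_eventually_const[OF pp elim(2,1)] x by (auto simp: filterlim_iff)
      then have "\<forall>\<^sub>F n in sequentially. F (x n) (N a \<omega>) = F (x n) (N (x n) \<omega>)"
        by eventually_elim simp
      moreover have "(\<lambda>n. F (x n) (N a \<omega>)) \<longlonglongrightarrow> F a (N a \<omega>)"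
        using F[of "N a \<omega>"] a x unfolding continuous_on_sequentially comp_def by blast
      ultimately show ?case
        by (rule Lim_transform_eventually[rotated])
    qed
    show "AE \<omega> in M. norm (F (x n) (N (x n) \<omega>)) \<le> W \<omega>" for n
      using x T[of n] by (intro AE_I2) (auto intro!: W(2))
  qed measurable
  then show "((\<lambda>s. expectation (\<lambda>\<omega>. F s (N s \<omega>))) \<circ> x) \<longlonglongrightarrow> expectation (\<lambda>\<omega>. F a (N a \<omega>))"
    by (simp add: comp_def)
qed

text \<open>If f(n) is the sum of \<open>g k\<close> over \<open>k < n\<close>, then
  \<open>g\<close> is the increment of f at a jump and \<open>g * rate\<close> is the generator
  applied to f. Domination is asked of \<open>g * rate\<close> only; integrability of the sum is a
  conclusion, since its expectation equals the integral of a continuous function over a compact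
  interval.\<close>

proposition dynkin:
  fixes g :: "nat \<Rightarrow> real"
  assumes g: "\<And>k. 0 \<le> g k"
    and dom: "\<And>T. \<exists>W. integrable M W \<and> (\<forall>s\<in>{0..T}. \<forall>\<omega>\<in>space M. g (N s \<omega>) * rate s (N s \<omega>) \<le> W \<omega>)"
    and t: "0 \<le> t"
  shows "integrable M (\<lambda>\<omega>. \<Sum>k<N t \<omega>. g k)"
    and "((\<lambda>t. expectation (\<lambda>\<omega>. \<Sum>k<N t \<omega>. g k)) has_real_derivative
        expectation (\<lambda>\<omega>. g (N t \<omega>) * rate t (N t \<omega>))) (at t within {0..})"
proof -
  define h where "h s = expectation (\<lambda>\<omega>. g (N s \<omega>) * rate s (N s \<omega>))" for s
  have h_nonneg: "0 \<le> h s" if "0 \<le> s" for s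
    unfolding h_def using that by (intro integral_nonneg_AE AE_I2 mult_nonneg_nonneg g rate_nonneg)
  have h: "continuous_on {0..} h"
    unfolding h_def
  proof (rule continuous_expectation_counting)
    show "continuous_on {0..} (\<lambda>s. g k * rate s k)" for k
      by (intro continuous_intros continuous_rate)
    fix T
    obtain W where "integrable M W" "\<forall>s\<in>{0..T}. \<forall>\<omega>\<in>space M. g (N s \<omega>) * rate s (N s \<omega>) \<le> W \<omega>"
      using dom by blast
    then show "\<exists>W. integrable M W \<and> (\<forall>s\<in>{0..T}. \<forall>\<omega>\<in>space M. \<bar>g (N s \<omega>) * rate s (N s \<omega>)\<bar> \<le> W \<omega>)"
      using g rate_nonneg by (intro exI[of _ W]) (auto simp: abs_mult)
  qed
  have nn_h: "(\<integral>\<^sup>+\<omega>. ennreal (g (N s \<omega>)) * ennreal (rate s (N s \<omega>)) \<partial>M) = ennreal (h s)" if s: "0 \<le> s" for s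
  proof -
    obtain W where W: "integrable M W" "\<forall>\<omega>\<in>space M. g (N s \<omega>) * rate s (N s \<omega>) \<le> W \<omega>"
      using dom[of s] s by force
    have "integrable M (\<lambda>\<omega>. g (N s \<omega>) * rate s (N s \<omega>))"
    proof (rule Bochner_Integration.integrable_bound[OF W(1)])
      show "AE \<omega> in M. norm (g (N s \<omega>) * rate s (N s \<omega>)) \<le> norm (W \<omega>)"
        using W(2) g rate_nonneg[OF s] by (intro AE_I2) (force simp: abs_mult)
    qed measurable
    then show ?thesis
      using g rate_nonneg[OF s] unfolding h_def
      by (simp add: ennreal_mult[symmetric] nn_integral_eq_integral)
  qed
  have nn: "(\<integral>\<^sup>+\<omega>. ennreal (\<Sum>k<N t \<omega>. g k) \<partial>M) = ennreal (integral {0..t} h)" if t: "0 \<le> t" for t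
  proof -
    have ht: "continuous_on {0..t} h"
      using h by (rule continuous_on_subset) auto
    have "(\<integral>\<^sup>+\<omega>. ennreal (\<Sum>k<N t \<omega>. g k) \<partial>M) = (\<integral>\<^sup>+\<omega>. (\<Sum>k<N t \<omega>. ennreal (g k)) \<partial>M)"
      using g by (simp add: sum_ennreal)
    also have "\<dots> = (\<integral>\<^sup>+s. indicator {0..t} s * (\<integral>\<^sup>+\<omega>. ennreal (g (N s \<omega>)) * ennreal (rate s (N s \<omega>)) \<partial>M) \<partial>lborel)"
      by (rule nn_expectation_sum_counting)
    also have "\<dots> = (\<integral>\<^sup>+s. ennreal (indicator {0..t} s *\<^sub>R h s) \<partial>lborel)"
      by (intro nn_integral_cong) (auto simp: indicator_def nn_h)
    also have "\<dots> = ennreal (set_lebesgue_integral lborel {0..t} h)"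
      unfolding set_lebesgue_integral_def
      using borel_integrable_atLeastAtMost'[OF ht] h_nonneg
      by (intro nn_integral_eq_integral) (auto simp: set_integrable_def indicator_def)
    also have "set_lebesgue_integral lborel {0..t} h = integral {0..t} h"
      by (intro set_borel_integral_eq_integral borel_integrable_atLeastAtMost'[OF ht])
    finally show ?thesis .
  qed
  show "integrable M (\<lambda>\<omega>. \<Sum>k<N t \<omega>. g k)"
    using nn[OF t] g by (intro integrableI_nonneg) (auto intro!: sum_nonneg)
  have E: "expectation (\<lambda>\<omega>. \<Sum>k<N t \<omega>. g k) = integral {0..t} h" if "0 \<le> t" for t
  proof -
    have "0 \<le> integral {0..t} h"
      by (intro integral_nonneg integrable_continuous_real continuous_on_subset[OF h]) (auto intro: h_nonneg)
    then show ?thesis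
      using nn[OF that] g by (subst integral_eq_nn_integral) (auto intro!: sum_nonneg)
  qed
  \<comment> \<open>Extending the compact interval to \<open>t + 1\<close> keeps \<open>t\<close>
    away from its right end, so near \<open>t\<close> it coincides with the half-line.\<close>
  have "((\<lambda>t. integral {0..t} h) has_real_derivative h t) (at t within {0..t+1})"
    using t by (intro integral_has_real_derivative continuous_on_subset[OF h]) auto
  then have "((\<lambda>t. expectation (\<lambda>\<omega>. \<Sum>k<N t \<omega>. g k)) has_real_derivative h t) (at t within {0..t+1})"
    by (rule has_field_derivative_transform_within[OF _ zero_less_one]) (use t in \<open>auto simp: E\<close>)
  also have "at t within {0..t+1} = at t within {0..}"
    using t by (intro at_within_nhd[of _ "{..<t+1}"]) auto
  finally show "((\<lambda>t. expectation (\<lambda>\<omega>. \<Sum>k<N t \<omega>. g k)) has_real_derivative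
        expectation (\<lambda>\<omega>. g (N t \<omega>) * rate t (N t \<omega>))) (at t within {0..})"
    by (simp add: h_def)
qed

end

section \<open>Moments\<close>

lemma sum_odd_eq_square: "(\<Sum>k<n. 2 * real k + 1) = (real n)\<^sup>2"
  by (induction n) (auto simp: power2_eq_square algebra_simps)

lemma sum_odd_truncated: "(\<Sum>k<m. if k < n then 2 * real k + 1 else 0) = (real (min m n))\<^sup>2"
proof -
  have "(\<Sum>k<m. if k < n then 2 * real k + 1 else 0) = (\<Sum>k<min m n. 2 * real k + 1)"
    by (intro sum.mono_neutral_cong_right) auto
  then show ?thesis
    by (simp add: sum_odd_eq_square)
qed

lemma real_le_square: "real n \<le> (real n)\<^sup>2"
  using self_le_power[of "real n" 2] by (cases n) auto

context lipschitz_self_exciting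
begin

definition base_rate where "base_rate = lam 0 + \<alpha> * \<gamma>"

lemma base_rate_nonneg: "0 \<le> base_rate"
  unfolding base_rate_def using lam_nonneg[of 0] gamma alpha_nonneg by simp

text \<open>A slope uniform in time is enough to show that the moments are finite; the decaying
  slope of \<open>rate_le\<close> returns in the growth estimates.\<close>

lemma rate_le_affine:
  assumes "0 \<le> t"
  shows "rate t k \<le> base_rate + real k"
proof -
  have "\<alpha> / (t + 1) * real k \<le> 1 * real k"
    using assms alpha_less_1 by (intro mult_right_mono) auto
  then show ?thesis
    using rate_le[OF assms, of k] by (simp add: base_rate_def)
qed

lemma odd_times_rate_le:
  assumes "0 \<le> t" "k \<le> n"
  shows "(2 * real k + 1) * rate t k \<le> (2 * real n + 1) * (base_rate + real n)"
  using assms rate_nonneg[of t k] rate_le_affine[of t k] by (intro mult_mono) auto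

text \<open>Using one constant K for both the square and the 1 makes \<open>exp (K * t) - 1\<close>
  an exact solution of f' = K f + K with f(0) = 0, which serves as the comparison function for the
  truncated moment.\<close>

lemma odd_times_affine_le:
  "(2 * real k + 1) * (base_rate + real k) \<le> (3 * base_rate + 3) * ((real k)\<^sup>2 + 1)"
proof -
  have "(2 * real k + 1) * (base_rate + real k) = 2 * (real k)\<^sup>2 + (2 * base_rate + 1) * real k + base_rate"
    by (simp add: power2_eq_square algebra_simps)
  also have "\<dots> \<le> 2 * (real k)\<^sup>2 + (2 * base_rate + 1) * (real k)\<^sup>2 + base_rate"
    using base_rate_nonneg real_le_square[of k] by (intro add_mono mult_left_mono) auto
  also have "\<dots> \<le> (3 * base_rate + 3) * ((real k)\<^sup>2 + 1)"
    using base_rate_nonneg by (simp add: algebra_simps)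
  finally show ?thesis .
qed

text \<open>Truncating the count makes all expectations finite a priori; the bound is uniform in the level.\<close>

lemma truncated_second_moment:
  assumes t: "0 \<le> t"
  shows "expectation (\<lambda>\<omega>. (real (min (N t \<omega>) n))\<^sup>2) \<le> exp ((3 * base_rate + 3) * t) - 1"
proof -
  define g where "g k = (if k < n then 2 * real k + 1 else 0)" for k
  define K where "K = 3 * base_rate + 3"
  have g: "0 \<le> g k" for k
    by (simp add: g_def)
  have sum_g: "(\<Sum>k<m. g k) = (real (min m n))\<^sup>2" for m
    unfolding g_def by (rule sum_odd_truncated)
  have g_rate: "g k * rate s k \<le> (2 * real n + 1) * (base_rate + real n)" if "0 \<le> s" for s k
    using odd_times_rate_le[OF that, of k n] base_rate_nonneg by (auto simp: g_def)
  have dom: "\<exists>W. integrable M W \<and> (\<forall>s\<in>{0..T}. \<forall>\<omega>\<in>space M. g (N s \<omega>) * rate s (N s \<omega>) \<le> W \<omega>)" for T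
    using g_rate by (intro exI[of _ "\<lambda>_. (2 * real n + 1) * (base_rate + real n)"]) auto
  note D = dynkin[of g, OF g dom, unfolded sum_g]
  let ?Q = "\<lambda>t. expectation (\<lambda>\<omega>. (real (min (N t \<omega>) n))\<^sup>2)"
  have "?Q t \<le> exp (K * t) - 1"
  proof (rule gronwall_differential[where k = "\<lambda>_. K" and c = "\<lambda>_. K" and p = "\<lambda>t. K * t"
        and f = ?Q and w = "\<lambda>t. exp (K * t) - 1"])
    fix s :: real assume s: "0 \<le> s"
    show "(?Q has_real_derivative expectation (\<lambda>\<omega>. g (N s \<omega>) * rate s (N s \<omega>))) (at s within {0..})"
      by (rule D(2)[OF s])
    show "((\<lambda>t. exp (K * t) - 1) has_real_derivative K * exp (K * s)) (at s within {0..})"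
      by (auto intro!: derivative_eq_intros)
    show "((\<lambda>t. K * t) has_real_derivative K) (at s within {0..})"
      by (auto intro!: derivative_eq_intros)
    show "K * (exp (K * s) - 1) + K \<le> K * exp (K * s)"
      by (simp add: algebra_simps)
    have le: "g k * rate s k \<le> K * (real (min k n))\<^sup>2 + K" for k
    proof (cases "k < n")
      case True
      have "g k * rate s k \<le> (2 * real k + 1) * (base_rate + real k)"
        using True rate_le_affine[OF s, of k] by (auto simp: g_def intro!: mult_left_mono)
      then show ?thesis
        using odd_times_affine_le[of k] True by (simp add: K_def algebra_simps)
    qed (use base_rate_nonneg in \<open>auto simp: g_def K_def\<close>)
    have "expectation (\<lambda>\<omega>. g (N s \<omega>) * rate s (N s \<omega>)) \<le>
        expectation (\<lambda>\<omega>. K * (real (min (N s \<omega>) n))\<^sup>2 + K)"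
    proof (rule integral_mono)
      show "integrable M (\<lambda>\<omega>. g (N s \<omega>) * rate s (N s \<omega>))"
        using g g_rate[OF s] rate_nonneg[OF s]
        by (intro integrable_const_bound[where B = "(2 * real n + 1) * (base_rate + real n)"])
          (auto simp: abs_mult intro!: AE_I2)
      show "integrable M (\<lambda>\<omega>. K * (real (min (N s \<omega>) n))\<^sup>2 + K)"
        using D(1)[OF s] by simp
    qed (rule le)
    also have "\<dots> = K * ?Q s + K"
      using D(1)[OF s] by (simp add: prob_space)
    finally show "expectation (\<lambda>\<omega>. g (N s \<omega>) * rate s (N s \<omega>)) \<le> K * ?Q s + K" .
  qed (use t in auto)
  then show ?thesis
    by (simp add: K_def)
qed

text \<open>Monotone convergence in the truncation level: the truncated moments increase and stay
  below a bound free of the level.\<close>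

lemma integrable_square_counting:
  assumes t: "0 \<le> t"
  shows "integrable M (\<lambda>\<omega>. (real (N t \<omega>))\<^sup>2)"
proof -
  let ?f = "\<lambda>n \<omega>. (real (min (N t \<omega>) n))\<^sup>2"
  have int: "integrable M (?f n)" for n
    by (intro integrable_const_bound[where B = "(real n)\<^sup>2"]) (auto intro!: AE_I2 power_mono)
  have mono: "mono (\<lambda>n. ?f n \<omega>)" for \<omega>
    by (intro monoI power_mono) auto
  have "incseq (\<lambda>n. expectation (?f n))"
    using int by (intro monoI integral_mono) (auto intro!: power_mono)
  then obtain L where L: "(\<lambda>n. expectation (?f n)) \<longlonglongrightarrow> L"
    using incseq_convergent truncated_second_moment[OF t] by metis
  have lim: "(\<lambda>n. ?f n \<omega>) \<longlonglongrightarrow> (real (N t \<omega>))\<^sup>2" for \<omega>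
    by (rule tendsto_eventually) (auto intro!: eventually_mono[OF eventually_ge_at_top[of "N t \<omega>"]])
  show ?thesis
    by (rule integrable_monotone_convergence[OF int _ _ L]) (use mono lim in auto)
qed

lemma integrable_counting:
  assumes t: "0 \<le> t"
  shows "integrable M (\<lambda>\<omega>. real (N t \<omega>))"
proof (rule Bochner_Integration.integrable_bound[OF integrable_square_counting[OF t]])
  show "AE \<omega> in M. norm (real (N t \<omega>)) \<le> norm ((real (N t \<omega>))\<^sup>2)"
    using real_le_square by (intro AE_I2) (simp only: real_norm_def abs_of_nat abs_power2)
qed measurable

text \<open>Counts increase in time and the affine rate bound does not depend on time, so the count
  at the right endpoint dominates throughout. This makes \<open>dynkin\<close> applicable to the
  untruncated square.\<close>

lemma dominated_odd_rate:
  "\<exists>W. integrable M W \<and> (\<forall>s\<in>{0..T}. \<forall>\<omega>\<in>space M. (2 * real (N s \<omega>) + 1) * rate s (N s \<omega>) \<le> W \<omega>)"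
proof (intro exI conjI ballI)
  \<comment> \<open>For negative \<open>T\<close> the interval is empty, but the dominating function
    must still be integrable; hence \<open>max 0 T\<close>.\<close>
  let ?n = "\<lambda>\<omega>. real (N (max 0 T) \<omega>)"
  let ?W = "\<lambda>\<omega>. 2 * (?n \<omega>)\<^sup>2 + (2 * base_rate + 1) * ?n \<omega> + base_rate"
  show "integrable M ?W"
    by (intro Bochner_Integration.integrable_add integrable_mult_right integrable_square_counting integrable_counting
        integrable_const) auto
  fix s \<omega> assume s: "s \<in> {0..T}" and \<omega>: "\<omega> \<in> space M"
  have "N s \<omega> \<le> N (max 0 T) \<omega>"
    using s by (intro counting_mono[OF pp \<omega>]) auto
  then show "(2 * real (N s \<omega>) + 1) * rate s (N s \<omega>) \<le> ?W \<omega>"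
    using odd_times_rate_le[of s "N s \<omega>" "N (max 0 T) \<omega>"] s
    by (simp add: power2_eq_square algebra_simps)
qed

text \<open>The factor 1 matches the hypothesis of \<open>dynkin\<close> for constant increments,
  the case of the first moment.\<close>

lemma dominated_rate:
  "\<exists>W. integrable M W \<and> (\<forall>s\<in>{0..T}. \<forall>\<omega>\<in>space M. 1 * rate s (N s \<omega>) \<le> W \<omega>)"
proof -
  obtain W where W: "integrable M W"
    "\<forall>s\<in>{0..T}. \<forall>\<omega>\<in>space M. (2 * real (N s \<omega>) + 1) * rate s (N s \<omega>) \<le> W \<omega>"
    using dominated_odd_rate by blast
  have "1 * rate s k \<le> (2 * real k + 1) * rate s k" if "0 \<le> s" for s k
    using rate_nonneg[OF that] by (intro mult_right_mono) auto
  then have "\<forall>s\<in>{0..T}. \<forall>\<omega>\<in>space M. 1 * rate s (N s \<omega>) \<le> W \<omega>"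
    using W(2) by (meson atLeastAtMost_iff order.trans)
  then show ?thesis
    using W(1) by blast
qed

lemma integrable_odd_rate:
  assumes s: "0 \<le> s"
  shows "integrable M (\<lambda>\<omega>. (2 * real (N s \<omega>) + 1) * rate s (N s \<omega>))"
proof -
  obtain W where W: "integrable M W" "\<forall>\<omega>\<in>space M. (2 * real (N s \<omega>) + 1) * rate s (N s \<omega>) \<le> W \<omega>"
    using dominated_odd_rate[of s] s by force
  show ?thesis
  proof (rule Bochner_Integration.integrable_bound[OF W(1)])
    show "AE \<omega> in M. norm ((2 * real (N s \<omega>) + 1) * rate s (N s \<omega>)) \<le> norm (W \<omega>)"
      using W(2) rate_nonneg[OF s] by (intro AE_I2) (force simp: abs_mult)
  qed measurable
qed

lemma integrable_rate:
  assumes s: "0 \<le> s"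
  shows "integrable M (\<lambda>\<omega>. rate s (N s \<omega>))"
proof (rule Bochner_Integration.integrable_bound[OF integrable_odd_rate[OF s]])
  have "1 * rate s k \<le> (2 * real k + 1) * rate s k" for k
    using rate_nonneg[OF s] by (intro mult_right_mono) auto
  then show "AE \<omega> in M. norm (rate s (N s \<omega>)) \<le> norm ((2 * real (N s \<omega>) + 1) * rate s (N s \<omega>))"
    using rate_nonneg[OF s] by (intro AE_I2) (simp add: abs_mult)
qed measurable

lemma mean_derivative:
  assumes "0 \<le> t"
  shows "((\<lambda>t. expectation (\<lambda>\<omega>. real (N t \<omega>))) has_real_derivative
    expectation (\<lambda>\<omega>. rate t (N t \<omega>))) (at t within {0..})"
  using dynkin(2)[of "\<lambda>_. 1", OF _ dominated_rate assms] by simp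

lemma second_moment_derivative:
  assumes "0 \<le> t"
  shows "((\<lambda>t. expectation (\<lambda>\<omega>. (real (N t \<omega>))\<^sup>2)) has_real_derivative
    expectation (\<lambda>\<omega>. (2 * real (N t \<omega>) + 1) * rate t (N t \<omega>))) (at t within {0..})"
  using dynkin(2)[of "\<lambda>k. 2 * real k + 1", OF _ dominated_odd_rate assms]
  by (simp add: sum_odd_eq_square)

section \<open>Linear growth of the mean\<close>

text \<open>The slope for which \<open>growth * (t + 1)\<close> solves m' = \<alpha> m / (t + 1) +
  \<open>base_rate\<close> exactly; here the contraction condition \<alpha> < 1 is used.\<close>

definition growth where "growth = base_rate / (1 - \<alpha>)"

lemma growth_nonneg: "0 \<le> growth"
  unfolding growth_def using base_rate_nonneg alpha_less_1 by simp

lemma growth_eq: "growth = \<alpha> * growth + base_rate"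
  using alpha_less_1 by (simp add: growth_def field_simps)

lemma ln_derivative:
  assumes "0 \<le> t"
  shows "((\<lambda>t. (c::real) * ln (t + 1)) has_real_derivative c / (t + 1)) (at t within {0..})"
  using assms by (auto intro!: derivative_eq_intros)

lemma mean_rate_le_mean:
  assumes s: "0 \<le> s"
  shows "expectation (\<lambda>\<omega>. rate s (N s \<omega>)) \<le> \<alpha> / (s + 1) * expectation (\<lambda>\<omega>. real (N s \<omega>)) + base_rate"
proof -
  have "expectation (\<lambda>\<omega>. rate s (N s \<omega>)) \<le> expectation (\<lambda>\<omega>. base_rate + \<alpha> / (s + 1) * real (N s \<omega>))"
    using rate_le[OF s] by (intro integral_mono integrable_rate s Bochner_Integration.integrable_add
        integrable_mult_right integrable_counting) (auto simp: base_rate_def)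
  also have "\<dots> = \<alpha> / (s + 1) * expectation (\<lambda>\<omega>. real (N s \<omega>)) + base_rate"
    using integrable_counting[OF s]
    by (subst Bochner_Integration.integral_add) (auto simp: prob_space simp del: times_divide_eq_left)
  finally show ?thesis .
qed

lemma mean_le:
  assumes "0 \<le> t"
  shows "expectation (\<lambda>\<omega>. real (N t \<omega>)) \<le> growth * (t + 1)"
proof (rule gronwall_differential[where p = "\<lambda>t. \<alpha> * ln (t + 1)" and k = "\<lambda>t. \<alpha> / (t + 1)"
      and c = "\<lambda>_. base_rate" and f = "\<lambda>t. expectation (\<lambda>\<omega>. real (N t \<omega>))" and w = "\<lambda>t. growth * (t + 1)"])
  fix s :: real assume s: "0 \<le> s"
  show "((\<lambda>t. growth * (t + 1)) has_real_derivative growth) (at s within {0..})"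
    by (auto intro!: derivative_eq_intros)
  show "\<alpha> / (s + 1) * (growth * (s + 1)) + base_rate \<le> growth"
    using s growth_eq by simp
qed (use assms growth_nonneg in \<open>auto simp del: times_divide_eq_left
    intro!: mean_derivative ln_derivative mean_rate_le_mean\<close>)

text \<open>The linear growth of the mean cancels the decay of the slope, so the bound is uniform in
  time. It controls the noise contribution to the mean square deviation.\<close>

lemma mean_rate_le:
  assumes t: "0 \<le> t"
  shows "expectation (\<lambda>\<omega>. rate t (N t \<omega>)) \<le> growth"
proof -
  have "\<alpha> / (t + 1) * expectation (\<lambda>\<omega>. real (N t \<omega>)) \<le> \<alpha> / (t + 1) * (growth * (t + 1))"
    using alpha_nonneg t by (intro mult_left_mono mean_le) auto
  then show ?thesis
    using mean_rate_le_mean[OF t] growth_eq t by simp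
qed

lemma integrable_deviation:
  assumes "0 \<le> t"
  shows "integrable M (\<lambda>\<omega>. (real (N t \<omega>) - x)\<^sup>2)"
  unfolding power2_diff
  using integrable_counting[OF assms] integrable_square_counting[OF assms] by auto

section \<open>Deviation from the fluid limit\<close>

lemma fluid_derivative:
  assumes "fluid_solution lam y0 y" "0 \<le> t"
  shows "((\<lambda>t. (t + 1) * y t) has_real_derivative lam (y t)) (at t within {0..})"
proof -
  have "(y has_real_derivative (lam (y t) - y t) / (t + 1)) (at t within {0..})"
    using assms by (simp add: fluid_solution_def)
  then have "((\<lambda>t. (t + 1) * y t) has_real_derivative
      1 * y t + (lam (y t) - y t) / (t + 1) * (t + 1)) (at t within {0..})"
    by (auto intro!: derivative_eq_intros)
  then show ?thesis
    using assms(2) by simp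
qed

text \<open>The same comparison as for the mean. Adding \<open>y0\<close> to the slope accommodates
  the initial value and keeps the supersolution property, because \<alpha> < 1 and \<open>y0\<close>
  is nonnegative.\<close>

lemma fluid_le:
  assumes y: "fluid_solution lam y0 y" and "0 \<le> t"
  shows "(t + 1) * y t \<le> (growth + y0) * (t + 1)"
proof (rule gronwall_differential[where p = "\<lambda>t. \<alpha> * ln (t + 1)" and k = "\<lambda>t. \<alpha> / (t + 1)"
      and c = "\<lambda>_. base_rate" and f = "\<lambda>t. (t + 1) * y t" and w = "\<lambda>t. (growth + y0) * (t + 1)"])
  have y0: "y 0 = y0" and y_nonneg: "\<And>t. 0 \<le> t \<Longrightarrow> 0 \<le> y t"
    using y by (auto simp: fluid_solution_def)
  show "(0 + 1) * y 0 \<le> (growth + y0) * (0 + 1)"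
    using y0 growth_nonneg by simp
  fix s :: real assume s: "0 \<le> s"
  show "((\<lambda>t. (growth + y0) * (t + 1)) has_real_derivative growth + y0) (at s within {0..})"
    by (auto intro!: derivative_eq_intros)
  have "\<alpha> * y0 \<le> 1 * y0"
    using y_nonneg[of 0] y0 alpha_less_1 by (intro mult_right_mono) auto
  then have "\<alpha> * (growth + y0) + base_rate \<le> growth + y0"
    using growth_eq by (simp add: distrib_left)
  then show "\<alpha> / (s + 1) * ((growth + y0) * (s + 1)) + base_rate \<le> growth + y0"
    using s by simp
  have "lam (y s) \<le> lam 0 + \<alpha> * y s"
    using lam_lipschitz[of "y s" 0] y_nonneg[OF s] by simp
  also have "\<dots> \<le> base_rate + \<alpha> * y s"
    using gamma alpha_nonneg by (simp add: base_rate_def)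
  finally show "lam (y s) \<le> \<alpha> / (s + 1) * ((s + 1) * y s) + base_rate"
    using s by simp
qed (use assms in \<open>auto intro!: fluid_derivative ln_derivative\<close>)

text \<open>Expanding the square leaves the two moments and a deterministic factor, each already
  differentiable. The result is gathered under one expectation so that it can be estimated
  pointwise; the extra \<open>rate\<close> is the jump correction, from (d + 1)^2 - d^2 = 2 d +
  1.\<close>

lemma deviation_derivative:
  assumes y: "fluid_solution lam y0 y" and t: "0 \<le> t"
  shows "((\<lambda>t. expectation (\<lambda>\<omega>. (real (N t \<omega>) - (t + 1) * y t)\<^sup>2)) has_real_derivative
    expectation (\<lambda>\<omega>. 2 * (real (N t \<omega>) - (t + 1) * y t) * (rate t (N t \<omega>) - lam (y t)) + rate t (N t \<omega>)))
    (at t within {0..})"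
proof -
  define u where "u t = (t + 1) * y t" for t
  define m where "m t = expectation (\<lambda>\<omega>. real (N t \<omega>))" for t
  define q where "q t = expectation (\<lambda>\<omega>. (real (N t \<omega>))\<^sup>2)" for t
  note u' = fluid_derivative[OF y t, folded u_def]
  note m' = mean_derivative[OF t, folded m_def]
  note q' = second_moment_derivative[OF t, folded q_def]
  have v: "expectation (\<lambda>\<omega>. (real (N s \<omega>) - u s)\<^sup>2) = q s - 2 * u s * m s + (u s)\<^sup>2" if "0 \<le> s" for s
  proof -
    have "expectation (\<lambda>\<omega>. (real (N s \<omega>) - u s)\<^sup>2) =
        expectation (\<lambda>\<omega>. (real (N s \<omega>))\<^sup>2 - 2 * u s * real (N s \<omega>) + (u s)\<^sup>2)"
      by (simp add: power2_diff algebra_simps)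
    then show ?thesis
      using integrable_counting[OF that] integrable_square_counting[OF that]
      by (simp add: m_def q_def prob_space)
  qed
  have v': "expectation (\<lambda>\<omega>. 2 * (real (N t \<omega>) - u t) * (rate t (N t \<omega>) - lam (y t)) + rate t (N t \<omega>)) =
      expectation (\<lambda>\<omega>. (2 * real (N t \<omega>) + 1) * rate t (N t \<omega>)) - 2 * u t * expectation (\<lambda>\<omega>. rate t (N t \<omega>))
      - 2 * lam (y t) * m t + 2 * u t * lam (y t)"
  proof -
    have "expectation (\<lambda>\<omega>. 2 * (real (N t \<omega>) - u t) * (rate t (N t \<omega>) - lam (y t)) + rate t (N t \<omega>)) =
        expectation (\<lambda>\<omega>. (2 * real (N t \<omega>) + 1) * rate t (N t \<omega>) - 2 * u t * rate t (N t \<omega>)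
          - 2 * lam (y t) * real (N t \<omega>) + 2 * u t * lam (y t))"
      by (intro Bochner_Integration.integral_cong refl) (simp add: algebra_simps)
    also have "\<dots> = expectation (\<lambda>\<omega>. (2 * real (N t \<omega>) + 1) * rate t (N t \<omega>))
        - 2 * u t * expectation (\<lambda>\<omega>. rate t (N t \<omega>)) - 2 * lam (y t) * m t + 2 * u t * lam (y t)"
      using integrable_odd_rate[OF t] integrable_rate[OF t] integrable_counting[OF t]
      by (simp add: m_def prob_space del: distrib_right_numeral)
    finally show ?thesis .
  qed
  have "((\<lambda>t. q t - 2 * u t * m t + (u t)\<^sup>2) has_real_derivative
      expectation (\<lambda>\<omega>. 2 * (real (N t \<omega>) - u t) * (rate t (N t \<omega>) - lam (y t)) + rate t (N t \<omega>)))
      (at t within {0..})"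
    unfolding v' by (rule derivative_eq_intros u' m' q' refl)+ (simp add: algebra_simps)
  then have "((\<lambda>t. expectation (\<lambda>\<omega>. (real (N t \<omega>) - u t)\<^sup>2)) has_real_derivative
      expectation (\<lambda>\<omega>. 2 * (real (N t \<omega>) - u t) * (rate t (N t \<omega>) - lam (y t)) + rate t (N t \<omega>)))
      (at t within {0..})"
    by (rule has_field_derivative_transform_within[OF _ zero_less_one]) (use t v in auto)
  then show ?thesis
    by (simp add: u_def)
qed

text \<open>The Lipschitz bound compares \<open>lam\<close> at two arguments differing by (N - u +
  \<gamma>) / (t + 1). The part N - u gives the quadratic term; the offset \<gamma> gives a term
  linear in the deviation, which has bounded mean after division by t + 1; the mean jump rate adds
  \<open>growth\<close>.\<close>

lemma deviation_derivative_le: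
  assumes y: "fluid_solution lam y0 y" and t: "0 \<le> t"
  shows "expectation (\<lambda>\<omega>. 2 * (real (N t \<omega>) - (t + 1) * y t) * (rate t (N t \<omega>) - lam (y t)) + rate t (N t \<omega>))
    \<le> 2 * \<alpha> / (t + 1) * expectation (\<lambda>\<omega>. (real (N t \<omega>) - (t + 1) * y t)\<^sup>2)
      + (2 * \<alpha> * \<gamma> * (2 * growth + y0) + growth)"
proof -
  define u where "u = (t + 1) * y t"
  have yt: "0 \<le> y t"
    using y t by (simp add: fluid_solution_def)
  then have u: "0 \<le> u"
    using t by (simp add: u_def)
  define b where "b = 2 * \<alpha> / (t + 1)"
  have b: "0 \<le> b"
    using alpha_nonneg t by (simp add: b_def)
  have pointwise: "2 * (real k - u) * (rate t k - lam (y t)) + rate t k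
      \<le> b * (real k - u)\<^sup>2 + b * \<gamma> * (real k + u) + rate t k" for k
  proof -
    have "y t = u / (t + 1)"
      using t by (simp add: u_def)
    then have "\<bar>rate t k - lam (y t)\<bar> \<le> \<alpha> * \<bar>(real k + \<gamma>) / (t + 1) - u / (t + 1)\<bar>"
      unfolding rate_def using lam_lipschitz[of "(real k + \<gamma>) / (t + 1)" "y t"] gamma t yt by simp
    also have "(real k + \<gamma>) / (t + 1) - u / (t + 1) = (real k - u + \<gamma>) / (t + 1)"
      by (simp add: diff_divide_distrib add_divide_distrib)
    also have "\<alpha> * \<bar>(real k - u + \<gamma>) / (t + 1)\<bar> \<le> \<alpha> * ((\<bar>real k - u\<bar> + \<gamma>) / (t + 1))"
      using alpha_nonneg t gamma by (intro mult_left_mono) (auto simp: divide_right_mono)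
    finally have *: "\<bar>rate t k - lam (y t)\<bar> \<le> \<alpha> * ((\<bar>real k - u\<bar> + \<gamma>) / (t + 1))" .
    have "2 * (real k - u) * (rate t k - lam (y t)) \<le> 2 * (\<bar>real k - u\<bar> * \<bar>rate t k - lam (y t)\<bar>)"
      using abs_ge_self[of "(real k - u) * (rate t k - lam (y t))"]
      unfolding abs_mult mult.assoc by (rule mult_left_mono) simp
    also have "\<dots> \<le> 2 * (\<bar>real k - u\<bar> * (\<alpha> * ((\<bar>real k - u\<bar> + \<gamma>) / (t + 1))))"
      using * by (intro mult_left_mono) auto
    also have "\<dots> = b * (real k - u)\<^sup>2 + b * \<gamma> * \<bar>real k - u\<bar>"
    proof -
      have "2 * (d * (\<alpha> * ((d + \<gamma>) / (t + 1)))) = b * d\<^sup>2 + b * \<gamma> * d" for d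
        by (simp add: b_def power2_eq_square add_divide_distrib algebra_simps)
      from this[of "\<bar>real k - u\<bar>"] show ?thesis
        by (simp only: power2_abs)
    qed
    \<comment> \<open>The triangle inequality suffices here, because the mean count and
      \<open>u\<close> both grow at most linearly.\<close>
    also have "b * \<gamma> * \<bar>real k - u\<bar> \<le> b * \<gamma> * (real k + u)"
      using b gamma u by (intro mult_left_mono) auto
    finally show ?thesis by simp
  qed
  note [simp] = integrable_rate[OF t] integrable_counting[OF t] integrable_deviation[OF t]
  have int: "integrable M (\<lambda>\<omega>. 2 * (real (N t \<omega>) - u) * (rate t (N t \<omega>) - lam (y t)) + rate t (N t \<omega>))"
  proof -
    \<comment> \<open>Expanding isolates the product of count and rate, whose integrability is known
      in this form.\<close>
    have "integrable M (\<lambda>\<omega>. (2 * real (N t \<omega>) + 1) * rate t (N t \<omega>) - 2 * u * rate t (N t \<omega>)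
          - 2 * lam (y t) * real (N t \<omega>) + 2 * u * lam (y t))"
      using integrable_odd_rate[OF t] by (simp del: distrib_right_numeral)
    then show ?thesis
      by (rule Bochner_Integration.integrable_cong[THEN iffD1, rotated -1]) (simp_all add: algebra_simps)
  qed
  have "expectation (\<lambda>\<omega>. 2 * (real (N t \<omega>) - u) * (rate t (N t \<omega>) - lam (y t)) + rate t (N t \<omega>))
    \<le> expectation (\<lambda>\<omega>. b * (real (N t \<omega>) - u)\<^sup>2 + b * \<gamma> * (real (N t \<omega>) + u) + rate t (N t \<omega>))"
    by (rule integral_mono[OF int]) (simp, rule pointwise)
  also have "\<dots> = b * expectation (\<lambda>\<omega>. (real (N t \<omega>) - u)\<^sup>2)
      + b * \<gamma> * (expectation (\<lambda>\<omega>. real (N t \<omega>)) + u) + expectation (\<lambda>\<omega>. rate t (N t \<omega>))"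
    by (simp add: prob_space)
  also have "\<dots> \<le> b * expectation (\<lambda>\<omega>. (real (N t \<omega>) - u)\<^sup>2)
      + b * \<gamma> * (growth * (t + 1) + (growth + y0) * (t + 1)) + growth"
    using mean_le[OF t] fluid_le[OF y t] mean_rate_le[OF t] b gamma
    by (intro add_mono mult_left_mono) (auto simp: u_def)
  also have "b * \<gamma> * (growth * (t + 1) + (growth + y0) * (t + 1)) = 2 * \<alpha> * \<gamma> * (2 * growth + y0)"
    using t by (simp add: b_def field_simps)
  finally show ?thesis
    by (simp add: b_def u_def)
qed

text \<open>The process starts at 0, so the initial squared error is exactly the square of
  \<open>y0\<close>. A general \<open>y0\<close> is allowed because the constant solution at the
  fixed point need not start at 0.\<close>

lemma deviation_le_supersolution:
  assumes y: "fluid_solution lam y0 y"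
    and w: "\<And>t. 0 \<le> t \<Longrightarrow> (w has_real_derivative w' t) (at t within {0..})"
    and w': "\<And>t. 0 \<le> t \<Longrightarrow>
      2 * \<alpha> / (t + 1) * w t + (2 * \<alpha> * \<gamma> * (2 * growth + y0) + growth) \<le> w' t"
    and init: "y0\<^sup>2 \<le> w 0"
    and t: "0 \<le> t"
  shows "expectation (\<lambda>\<omega>. (real (N t \<omega>) / (t + 1) - y t)\<^sup>2) \<le> w t / (t + 1)\<^sup>2"
proof -
  have "expectation (\<lambda>\<omega>. (real (N t \<omega>) - (t + 1) * y t)\<^sup>2) \<le> w t"
  proof (rule gronwall_differential[OF deviation_derivative[OF y] w _ deviation_derivative_le[OF y] w'])
    show "((\<lambda>t. 2 * \<alpha> * ln (t + 1)) has_real_derivative 2 * \<alpha> / (s + 1)) (at s within {0..})"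
      if "0 \<le> s" for s
      using ln_derivative[OF that, of "2 * \<alpha>"] .
    show "expectation (\<lambda>\<omega>. (real (N 0 \<omega>) - (0 + 1) * y 0)\<^sup>2) \<le> w 0"
      using init y by (simp add: fluid_solution_def prob_space)
  qed (use t in auto)
  moreover have "(real k / (t + 1) - y t)\<^sup>2 = (real k - (t + 1) * y t)\<^sup>2 / (t + 1)\<^sup>2" for k
    unfolding power_divide[symmetric] using t by (simp add: diff_divide_distrib)
  ultimately show ?thesis
    by (simp add: divide_right_mono)
qed

section \<open>Explicit supersolutions for the three ranges of \<alpha>\<close>

context
  fixes y0 y C
  assumes y: "fluid_solution lam y0 y"
  defines "C \<equiv> 2 * \<alpha> * \<gamma> * (2 * growth + y0) + growth"
begin

lemma C_nonneg: "0 \<le> C"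
proof -
  have "0 \<le> y 0" "y 0 = y0"
    using y by (auto simp: fluid_solution_def)
  then show ?thesis
    using gamma alpha_nonneg growth_nonneg by (simp add: C_def)
qed

lemma mean_square_error_less_half:
  assumes "\<alpha> < 1/2"
  obtains B where "\<And>t. 0 \<le> t \<Longrightarrow> expectation (\<lambda>\<omega>. (real (N t \<omega>) / (t + 1) - y t)\<^sup>2) \<le> B / (t + 1)"
proof
  \<comment> \<open>\<open>C / (1 - 2 * \<alpha>)\<close> solves 2 \<alpha> B + C = B, the condition
    for \<open>B * (t + 1)\<close> to be an exact solution. The added square of \<open>y0\<close>
    covers the initial value and, as 2 \<alpha> < 1, preserves the inequality.\<close>
  define B where "B = y0\<^sup>2 + C / (1 - 2 * \<alpha>)"
  fix t :: real assume t: "0 \<le> t"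
  have "2 * \<alpha> * y0\<^sup>2 \<le> 1 * y0\<^sup>2"
    using assms by (intro mult_right_mono) auto
  moreover have "2 * \<alpha> * (C / (1 - 2 * \<alpha>)) + C = C / (1 - 2 * \<alpha>)"
    using assms by (simp add: field_simps)
  ultimately have B: "2 * \<alpha> * B + C \<le> B"
    by (simp add: B_def distrib_left)
  have "expectation (\<lambda>\<omega>. (real (N t \<omega>) / (t + 1) - y t)\<^sup>2) \<le> B * (t + 1) / (t + 1)\<^sup>2"
  proof (rule deviation_le_supersolution[OF y _ _ _ t])
    show "((\<lambda>t. B * (t + 1)) has_real_derivative B) (at s within {0..})" for s
      by (auto intro!: derivative_eq_intros)
    show "2 * \<alpha> / (s + 1) * (B * (s + 1)) + (2 * \<alpha> * \<gamma> * (2 * growth + y0) + growth) \<le> B"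
      if "0 \<le> s" for s
      using that B by (simp add: C_def)
    show "y0\<^sup>2 \<le> B * (0 + 1)"
      using assms C_nonneg by (simp add: B_def)
  qed
  then show "expectation (\<lambda>\<omega>. (real (N t \<omega>) / (t + 1) - y t)\<^sup>2) \<le> B / (t + 1)"
    using t by (simp add: power2_eq_square)
qed

lemma mean_square_error_greater_half:
  assumes "1/2 < \<alpha>"
  obtains B where "\<And>t. 0 \<le> t \<Longrightarrow>
    expectation (\<lambda>\<omega>. (real (N t \<omega>) / (t + 1) - y t)\<^sup>2) \<le> B / (t + 1) powr (2 * (1 - \<alpha>))"
proof
  \<comment> \<open>\<open>- D * (t + 1)\<close> is a particular solution and the power term solves
    the homogeneous equation; \<open>B\<close> is chosen so that their sum starts at the square of
    \<open>y0\<close>.\<close>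
  define D where "D = C / (2 * \<alpha> - 1)"
  define B where "B = y0\<^sup>2 + D"
  fix t :: real assume t: "0 \<le> t"
  have D: "2 * \<alpha> * D = D + C" and D_nonneg: "0 \<le> D"
    using assms C_nonneg by (auto simp: D_def field_simps)
  have "expectation (\<lambda>\<omega>. (real (N t \<omega>) / (t + 1) - y t)\<^sup>2) \<le>
      (B * (t + 1) powr (2 * \<alpha>) - D * (t + 1)) / (t + 1)\<^sup>2"
  proof (rule deviation_le_supersolution[OF y _ _ _ t])
    fix s :: real assume s: "0 \<le> s"
    show "((\<lambda>t. B * (t + 1) powr (2 * \<alpha>) - D * (t + 1)) has_real_derivative
        2 * \<alpha> * B * (s + 1) powr (2 * \<alpha> - 1) - D) (at s within {0..})"
      using s by (auto intro!: derivative_eq_intros)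
    have "(s + 1) powr (2 * \<alpha>) = (s + 1) powr (2 * \<alpha> - 1) * (s + 1)"
      using s powr_add[of "s + 1" "2 * \<alpha> - 1" 1] by simp
    then have "2 * \<alpha> / (s + 1) * (B * (s + 1) powr (2 * \<alpha>) - D * (s + 1)) =
        2 * \<alpha> * B * (s + 1) powr (2 * \<alpha> - 1) - 2 * \<alpha> * D"
      using s by (simp add: right_diff_distrib)
    then show "2 * \<alpha> / (s + 1) * (B * (s + 1) powr (2 * \<alpha>) - D * (s + 1)) +
        (2 * \<alpha> * \<gamma> * (2 * growth + y0) + growth) \<le> 2 * \<alpha> * B * (s + 1) powr (2 * \<alpha> - 1) - D"
      using D by (simp add: C_def)
  qed (simp add: B_def)
  also have "\<dots> \<le> B * (t + 1) powr (2 * \<alpha>) / (t + 1)\<^sup>2"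
    using D_nonneg t by (intro divide_right_mono) auto
  also have "\<dots> = B / (t + 1) powr (2 * (1 - \<alpha>))"
  proof -
    have "(t + 1)\<^sup>2 = (t + 1) powr (2 * \<alpha>) * (t + 1) powr (2 * (1 - \<alpha>))"
      using t by (simp add: powr_add[symmetric] algebra_simps powr_numeral)
    then show ?thesis
      using t by simp
  qed
  finally show "expectation (\<lambda>\<omega>. (real (N t \<omega>) / (t + 1) - y t)\<^sup>2) \<le> B / (t + 1) powr (2 * (1 - \<alpha>))" .
qed

text \<open>At 1/2 the homogeneous solution is itself \<open>t + 1\<close>, so the constant forcing
  is resonant and contributes the factor \<open>ln (t + 1)\<close>. The constant \<open>A\<close>
  stays separate because the logarithm vanishes at time 0.\<close>

lemma mean_square_error_half:
  assumes "\<alpha> = 1/2"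
  obtains A B where "0 \<le> A" "0 \<le> B" "\<And>t. 0 \<le> t \<Longrightarrow>
    expectation (\<lambda>\<omega>. (real (N t \<omega>) / (t + 1) - y t)\<^sup>2) \<le> (A + B * ln (t + 1)) / (t + 1)"
proof
  show "0 \<le> y0\<^sup>2" "0 \<le> C"
    using C_nonneg by auto
  fix t :: real assume t: "0 \<le> t"
  have "expectation (\<lambda>\<omega>. (real (N t \<omega>) / (t + 1) - y t)\<^sup>2) \<le>
      (y0\<^sup>2 + C * ln (t + 1)) * (t + 1) / (t + 1)\<^sup>2"
  proof (rule deviation_le_supersolution[OF y _ _ _ t])
    fix s :: real assume s: "0 \<le> s"
    show "((\<lambda>t. (y0\<^sup>2 + C * ln (t + 1)) * (t + 1)) has_real_derivative
        y0\<^sup>2 + C * ln (s + 1) + C) (at s within {0..})"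
      using s by (auto intro!: derivative_eq_intros)
    show "2 * \<alpha> / (s + 1) * ((y0\<^sup>2 + C * ln (s + 1)) * (s + 1)) +
        (2 * \<alpha> * \<gamma> * (2 * growth + y0) + growth) \<le> y0\<^sup>2 + C * ln (s + 1) + C"
      unfolding C_def[symmetric] using s by (simp add: assms)
  qed simp
  then show "expectation (\<lambda>\<omega>. (real (N t \<omega>) / (t + 1) - y t)\<^sup>2) \<le> (y0\<^sup>2 + C * ln (t + 1)) / (t + 1)"
    using t by (simp add: power2_eq_square)
qed

end

end

section \<open>Asymptotics\<close>

text \<open>Nonnegativity makes \<open>lam\<close> a self-map of the complete set
  \<open>{0..}\<close>, on which it is a contraction.\<close>

lemma fixed_point_exists_unique:
  fixes lam :: "real \<Rightarrow> real"
  assumes nonneg: "\<And>x. 0 \<le> x \<Longrightarrow> 0 \<le> lam x"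
    and lipschitz: "\<alpha>-lipschitz_on {0..} lam" and \<alpha>: "\<alpha> < 1"
  shows "\<exists>!x\<in>{0..}. lam x = x"
proof (rule Banach_fix)
  show "dist (lam x) (lam y) \<le> \<alpha> * dist x y" if "x \<in> {0..}" "y \<in> {0..}" for x y
    using lipschitz_onD[OF lipschitz that] .
qed (use nonneg \<alpha> lipschitz_on_nonneg[OF lipschitz] in \<open>auto simp: complete_eq_closed\<close>)

lemma fluid_solution_fixed_point:
  assumes "0 \<le> x" "lam x = x"
  shows "fluid_solution lam x (\<lambda>_. x)"
  using assms by (simp add: fluid_solution_def)

context lipschitz_self_exciting
begin

lemma mean_square_tendsto_0:
  assumes y: "fluid_solution lam y0 y"
  shows "((\<lambda>t. expectation (\<lambda>\<omega>. (real (N t \<omega>) / (t + 1) - y t)\<^sup>2)) \<longlongrightarrow> 0) at_top"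
proof -
  \<comment> \<open>Enlarging the Lipschitz constant leaves only the case of a constant above \<open>1/2\<close>.\<close>
  define \<beta> where "\<beta> = (3 + \<alpha>) / 4"
  \<comment> \<open>\<beta> lies three quarters of the way from \<alpha> to 1, so it is at least 3/4
    and still below 1.\<close>
  have \<beta>: "\<alpha> \<le> \<beta>" "1/2 < \<beta>" "\<beta> < 1"
    using alpha_nonneg alpha_less_1 by (auto simp: \<beta>_def)
  interpret B: lipschitz_self_exciting M pts lam \<gamma> "\<beta>"
    using gamma lam_nonneg process lipschitz_on_le[OF lipschitz, of \<beta>] \<beta>
    by unfold_locales auto
  obtain B where B: "\<And>t. 0 \<le> t \<Longrightarrow> expectation (\<lambda>\<omega>. (real (N t \<omega>) / (t + 1) - y t)\<^sup>2)
      \<le> B / (t + 1) powr (2 * (1 - \<beta>))"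
    using B.mean_square_error_greater_half[OF y \<beta>(2)] by blast
  have "filterlim (\<lambda>t::real. t + 1) at_top at_top"
    using filterlim_tendsto_add_at_top[OF tendsto_const[of "1::real"] filterlim_ident]
    by (simp add: add.commute)
  then have "((\<lambda>t::real. (t + 1) powr - (2 * (1 - \<beta>))) \<longlongrightarrow> 0) at_top"
    using \<beta> by (intro tendsto_neg_powr) auto
  then have lim: "((\<lambda>t. B * (t + 1) powr - (2 * (1 - \<beta>))) \<longlongrightarrow> 0) at_top"
    by (rule tendsto_mult_right_zero)
  show ?thesis
  proof (rule tendsto_sandwich[OF _ _ tendsto_const lim])
    show "\<forall>\<^sub>F t in at_top. expectation (\<lambda>\<omega>. (real (N t \<omega>) / (t + 1) - y t)\<^sup>2)
        \<le> B * (t + 1) powr - (2 * (1 - \<beta>))"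
      using eventually_ge_at_top[of "0::real"]
    proof eventually_elim
      case (elim t)
      then show ?case
        using B[OF elim] by (simp only: powr_minus_divide times_divide_eq_right mult_1_right)
    qed
  qed (auto intro!: always_eventually)
qed

lemma mean_square_error_bigo_less_half:
  assumes y: "fluid_solution lam y0 y" and \<alpha>: "\<alpha> < 1/2"
  shows "(\<lambda>t. expectation (\<lambda>\<omega>. (real (N t \<omega>) / (t + 1) - y t)\<^sup>2)) \<in> O[at_top](\<lambda>t. 1 / t)"
proof -
  obtain B where B: "\<And>t. 0 \<le> t \<Longrightarrow> expectation (\<lambda>\<omega>. (real (N t \<omega>) / (t + 1) - y t)\<^sup>2) \<le> B / (t + 1)"
    using mean_square_error_less_half[OF y \<alpha>] by blast
  show ?thesis
  \<comment> \<open>Replacing \<open>t + 1\<close> by \<open>t\<close> in the denominator enlarges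
    the bound only for a nonnegative numerator, and \<open>B\<close> comes without a sign.\<close>
  proof (rule bigoI[where c = "\<bar>B\<bar>"])
    show "\<forall>\<^sub>F t in at_top. norm (expectation (\<lambda>\<omega>. (real (N t \<omega>) / (t + 1) - y t)\<^sup>2)) \<le> \<bar>B\<bar> * norm (1 / t)"
      using eventually_gt_at_top[of "0::real"]
    proof eventually_elim
      case (elim t)
      have "norm (expectation (\<lambda>\<omega>. (real (N t \<omega>) / (t + 1) - y t)\<^sup>2)) =
          expectation (\<lambda>\<omega>. (real (N t \<omega>) / (t + 1) - y t)\<^sup>2)"
        by simp
      also have "\<dots> \<le> B / (t + 1)"
        using elim by (intro B) auto
      also have "\<dots> \<le> \<bar>B\<bar> / t"
        using elim by (intro frac_le) auto
      finally show ?case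
        using elim by simp
    qed
  qed
qed

lemma mean_square_error_bigo_greater_half:
  assumes y: "fluid_solution lam y0 y" and \<alpha>: "1/2 < \<alpha>"
  shows "(\<lambda>t. expectation (\<lambda>\<omega>. (real (N t \<omega>) / (t + 1) - y t)\<^sup>2)) \<in> O[at_top](\<lambda>t. 1 / t powr (2 * (1 - \<alpha>)))"
proof -
  obtain B where B: "\<And>t. 0 \<le> t \<Longrightarrow> expectation (\<lambda>\<omega>. (real (N t \<omega>) / (t + 1) - y t)\<^sup>2)
      \<le> B / (t + 1) powr (2 * (1 - \<alpha>))"
    using mean_square_error_greater_half[OF y \<alpha>] by blast
  show ?thesis
  proof (rule bigoI[where c = "\<bar>B\<bar>"])
    show "\<forall>\<^sub>F t in at_top. norm (expectation (\<lambda>\<omega>. (real (N t \<omega>) / (t + 1) - y t)\<^sup>2))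
        \<le> \<bar>B\<bar> * norm (1 / t powr (2 * (1 - \<alpha>)))"
      using eventually_gt_at_top[of "0::real"]
    proof eventually_elim
      case (elim t)
      have "norm (expectation (\<lambda>\<omega>. (real (N t \<omega>) / (t + 1) - y t)\<^sup>2)) =
          expectation (\<lambda>\<omega>. (real (N t \<omega>) / (t + 1) - y t)\<^sup>2)"
        by simp
      also have "\<dots> \<le> B / (t + 1) powr (2 * (1 - \<alpha>))"
        using elim by (intro B) auto
      also have "\<dots> \<le> \<bar>B\<bar> / t powr (2 * (1 - \<alpha>))"
        using elim alpha_less_1 by (intro frac_le powr_mono2) auto
      finally show ?case
        by simp
    qed
  qed
qed

lemma mean_square_error_bigo_half:
  assumes y: "fluid_solution lam y0 y" and \<alpha>: "\<alpha> = 1/2"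
  shows "(\<lambda>t. expectation (\<lambda>\<omega>. (real (N t \<omega>) / (t + 1) - y t)\<^sup>2)) \<in> O[at_top](\<lambda>t. ln t / t)"
proof -
  obtain A B where "0 \<le> A" "0 \<le> B" and AB: "\<And>t. 0 \<le> t \<Longrightarrow>
      expectation (\<lambda>\<omega>. (real (N t \<omega>) / (t + 1) - y t)\<^sup>2) \<le> (A + B * ln (t + 1)) / (t + 1)"
    using mean_square_error_half[OF y \<alpha>] by blast
  show ?thesis
  \<comment> \<open>From e on, \<open>ln t\<close> is at least 1 and absorbs \<open>A\<close>; since
    also t + 1 \<le> t^2, \<open>ln (t + 1)\<close> is at most twice \<open>ln t\<close>.\<close>
  proof (rule bigoI[where c = "A + 2 * B"])
    show "\<forall>\<^sub>F t in at_top. norm (expectation (\<lambda>\<omega>. (real (N t \<omega>) / (t + 1) - y t)\<^sup>2))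
        \<le> (A + 2 * B) * norm (ln t / t)"
      using eventually_ge_at_top[of "exp 1 :: real"]
    proof eventually_elim
      case (elim t)
      have t: "2 \<le> t"
        using elim exp_ge_add_one_self[of 1] by simp
      have ln1: "1 \<le> ln t"
        using elim t by (simp add: ln_ge_iff)
      have "t + 1 \<le> t * t"
        using mult_right_mono[OF t, of t] t by linarith
      then have "ln (t + 1) \<le> ln (t * t)"
        using t by (subst ln_le_cancel_iff) auto
      then have ln2: "ln (t + 1) \<le> 2 * ln t"
        using t by (simp add: ln_mult)
      have "norm (expectation (\<lambda>\<omega>. (real (N t \<omega>) / (t + 1) - y t)\<^sup>2)) =
          expectation (\<lambda>\<omega>. (real (N t \<omega>) / (t + 1) - y t)\<^sup>2)"
        by simp
      also have "\<dots> \<le> (A + B * ln (t + 1)) / (t + 1)"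
        using t by (intro AB) auto
      also have "\<dots> \<le> (A * ln t + B * (2 * ln t)) / t"
        using t ln1 ln2 \<open>0 \<le> A\<close> \<open>0 \<le> B\<close> mult_left_mono[OF ln1, of A]
        by (intro frac_le add_mono mult_left_mono add_nonneg_nonneg mult_nonneg_nonneg) auto
      also have "\<dots> = (A + 2 * B) * norm (ln t / t)"
        using t ln1 by (simp add: algebra_simps add_divide_distrib)
      finally show ?case .
    qed
  qed
qed

end

theorem theorem3:
  fixes M :: "'a measure"
    and pts :: "'a \<Rightarrow> real set"
    and lam lam' :: "real \<Rightarrow> real"
    and \<gamma> \<alpha> :: real
  defines "Y \<equiv> normalized_count pts"
  assumes gamma: "0 \<le> \<gamma>"
    and rate: "rate_function lam lam'"
    and process: "self_exciting_process M pts lam \<gamma>"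
    and alpha: "0 < \<alpha>" "\<alpha> < 1"
    and lipschitz: "\<alpha>-lipschitz_on {0..} lam"
  shows "(\<exists>x\<ge>0. x = lam x \<and> (\<forall>z\<ge>0. z = lam z \<longrightarrow> z = x) \<and> tendsto_L2 M Y x) \<and>
    (\<forall>Ybar. (\<forall>\<omega>\<in>space M. fluid_solution lam (Y 0 \<omega>) Ybar) \<longrightarrow>
       (\<forall>t\<ge>0. integrable M (\<lambda>\<omega>. (Y t \<omega> - Ybar t)\<^sup>2)) \<and>
       (\<alpha> < 1/2 \<longrightarrow>
          (\<lambda>t. \<integral>\<omega>. (Y t \<omega> - Ybar t)\<^sup>2 \<partial>M) \<in> O[at_top](\<lambda>t. 1 / t)) \<and>
       (1/2 < \<alpha> \<longrightarrow>
          (\<lambda>t. \<integral>\<omega>. (Y t \<omega> - Ybar t)\<^sup>2 \<partial>M) \<in> O[at_top](\<lambda>t. 1 / t powr (2 * (1 - \<alpha>)))) \<and>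
       (\<alpha> = 1/2 \<longrightarrow>
          (\<lambda>t. \<integral>\<omega>. (Y t \<omega> - Ybar t)\<^sup>2 \<partial>M) \<in> O[at_top](\<lambda>t. ln t / t)))"
proof -
  interpret lipschitz_self_exciting M pts lam \<gamma> \<alpha>
    using gamma rate process lipschitz alpha by unfold_locales (auto simp: rate_function_def)
  have Y: "Y t \<omega> = real (counting pts t \<omega>) / (t + 1)" for t \<omega>
    by (simp add: Y_def normalized_count_def)
  have Y_measurable: "Y t \<in> borel_measurable M" for t
    unfolding Y[abs_def] by measurable
  have int: "integrable M (\<lambda>\<omega>. (Y t \<omega> - c)\<^sup>2)" if t: "0 \<le> t" for t c
  proof -
    have "(\<lambda>\<omega>. (Y t \<omega> - c)\<^sup>2) = (\<lambda>\<omega>. (real (counting pts t \<omega>) - (t + 1) * c)\<^sup>2 / (t + 1)\<^sup>2)"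
      unfolding power_divide[symmetric] Y using t by (simp add: diff_divide_distrib)
    then show ?thesis
      using integrable_deviation[OF t] by simp
  qed
  obtain x where x: "0 \<le> x" "lam x = x" and unique: "\<And>z. 0 \<le> z \<Longrightarrow> lam z = z \<Longrightarrow> z = x"
    using fixed_point_exists_unique[OF lam_nonneg lipschitz alpha(2)] by (metis atLeast_iff)
  have "((\<lambda>t. sqrt (\<integral>\<omega>. (Y t \<omega> - x)\<^sup>2 \<partial>M)) \<longlongrightarrow> sqrt 0) at_top"
    unfolding Y by (intro tendsto_real_sqrt mean_square_tendsto_0[OF fluid_solution_fixed_point[of x lam]] x)
  \<comment> \<open>The instance \<open>c = 0\<close> of \<open>int\<close> is the square
    integrability of \<open>Y\<close> itself.\<close>
  then have "tendsto_L2 M Y x"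
    using Y_measurable int[of _ 0] by (simp add: tendsto_L2_def)
  then have "\<exists>x\<ge>0. x = lam x \<and> (\<forall>z\<ge>0. z = lam z \<longrightarrow> z = x) \<and> tendsto_L2 M Y x"
    using x unique by metis
  moreover have "(\<forall>t\<ge>0. integrable M (\<lambda>\<omega>. (Y t \<omega> - Ybar t)\<^sup>2)) \<and>
       (\<alpha> < 1/2 \<longrightarrow>
          (\<lambda>t. \<integral>\<omega>. (Y t \<omega> - Ybar t)\<^sup>2 \<partial>M) \<in> O[at_top](\<lambda>t. 1 / t)) \<and>
       (1/2 < \<alpha> \<longrightarrow>
          (\<lambda>t. \<integral>\<omega>. (Y t \<omega> - Ybar t)\<^sup>2 \<partial>M) \<in> O[at_top](\<lambda>t. 1 / t powr (2 * (1 - \<alpha>)))) \<and>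
       (\<alpha> = 1/2 \<longrightarrow>
          (\<lambda>t. \<integral>\<omega>. (Y t \<omega> - Ybar t)\<^sup>2 \<partial>M) \<in> O[at_top](\<lambda>t. ln t / t))"
    if "\<forall>\<omega>\<in>space M. fluid_solution lam (Y 0 \<omega>) Ybar" for Ybar
  proof -
    \<comment> \<open>\<open>Y 0\<close> is formally a random variable, so the hypothesis speaks of
      every outcome. A probability space is nonempty, and a single outcome supplies the fluid
      equation.\<close>
    obtain \<omega> where "\<omega> \<in> space M"
      using not_empty by blast
    then have y: "fluid_solution lam (Y 0 \<omega>) Ybar"
      using that by blast
    show ?thesis
      using int mean_square_error_bigo_less_half[OF y] mean_square_error_bigo_greater_half[OF y]
        mean_square_error_bigo_half[OF y]
      unfolding Y by blast
  qed
  ultimately show ?thesis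
    by blast
qed

end
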